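(* Let $(n_i)_{i\ge 1}$ and $(k_i)_{i\ge 1}$ be sequences of real numbers with $1\le k_i\le n_i$ for all $i$, such that $\lim_{i\to\infty} n_i=\infty$ and \[ \lim_{i\to\infty}\frac{n_i}{k_i}=\alpha<\infty . \] Then \[ \lim_{i\to\infty}\lambda_{k_i,n_i}=\frac{\alpha^{\alpha+1}}{(\alpha-1)^{\alpha-1}}\left(\frac{2}{\alpha}\right)^{\frac{2}{2-\alpha}}, \] where for $\alpha=1$ (resp. $\alpha=2$) the right-hand side is understood as the limit of the expression as $\alpha\to1$ (resp. $\alpha\to 2$), which is $4$ (resp. $8e$). Here $\lambda_{k,n}$ is the first radial $(k,n)$-eigenvalue.
   Context: For real $0\le k\le n$, $\binom{n}{k}:=\frac{\Gamma(n+1)}{\Gamma(k+1)\Gamma(n-k+1)}$. For $\alpha\ge 1$, a function $u\in C^2(0,1)$ is called $\alpha$-convex if $\limsup_{r\to0}\frac{u'}{r}<\infty$, $u'\ge0$ and $u''+(\alpha-1)\frac{u'}{r}\ge0$ on $(0,1)$. For real $1\le k\le n$, set $\alpha=n/k$ and $S_{k,n}(u):=\binom{n-1}{k-1}\left(\frac{u'}{r}\right)^{k-1}\left(u''+\frac{n-k}{k}\frac{u'}{r}\right)$. An $\alpha$-convex function $u$ and a number $\lambda>0$ solve the radial $(k,n)$-eigenvalue problem if $S_{k,n}(u)=(-\lambda u)^k$ on $(0,1)$, $u(0)=-1$, $u(1)=0$ (endpoint values taken as limits). It is known that there is a unique such pair, denoted $(u_{k,n},\lambda_{k,n})$: the first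 radial $(k,n)$-eigenfunction and eigenvalue. It is also known that $\lambda_{k,n}^k=\inf\frac{E_{k,n}[u]}{I_{k,n}[u]}$, the infimum being over $\alpha$-convex $u$ with $u(1)=0$, $u(0)=-1$, where $E_{k,n}[u]=\frac1{k+1}\int_0^1(-u)S_{k,n}(u)\,r^{n-1}dr$ and $I_{k,n}[u]=\frac1{k+1}\int_0^1(-u)^{k+1}r^{n-1}dr$; the infimum is attained by $u_{k,n}$. For integer $k,n$, $\lambda_{k,n}$ is the first eigenvalue of the $k$-Hessian operator (the $k$-th elementary symmetric polynomial of the eigenvalues of the Hessian) on the unit ball of $\mathbb{R}^n$. *)

theory Defs
  imports "HOL-Analysis.Analysis" "HOL-Real_Asymp.Real_Asymp"
begin

definition real_binom :: "real \<Rightarrow> real \<Rightarrow> real" where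
  "real_binom n k = Gamma (n + 1) / (Gamma (k + 1) * Gamma (n - k + 1))"

text \<open>
  Real powers of nonnegative bases with the convention \<open>x\<^sup>0 = 1\<close> also for \<open>x = 0\<close>, whereas
  \<open>0 powr 0 = 0\<close>. This matters for the factor \<open>(u'/r)\<^bsup>k-1\<^esup>\<close> when \<open>k = 1\<close>.
\<close>
definition rpow :: "real \<Rightarrow> real \<Rightarrow> real" where
  "rpow x a = (if a = 0 then 1 else x powr a)"

definition C2_on :: "real set \<Rightarrow> (real \<Rightarrow> real) \<Rightarrow> bool" where
  "C2_on S u \<longleftrightarrow>
     u differentiable_on S \<and> deriv u differentiable_on S \<and> continuous_on S (deriv (deriv u))"

definition alpha_convex :: "real \<Rightarrow> (real \<Rightarrow> real) \<Rightarrow> bool" where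
  "alpha_convex \<alpha> u \<longleftrightarrow>
     C2_on {0<..<1} u \<and>
     Limsup (at_right 0) (\<lambda>r. ereal (deriv u r / r)) < \<infinity> \<and>
     (\<forall>r\<in>{0<..<1}. deriv u r \<ge> 0 \<and> deriv (deriv u) r + (\<alpha> - 1) * (deriv u r / r) \<ge> 0)"

definition radial_hessian :: "real \<Rightarrow> real \<Rightarrow> (real \<Rightarrow> real) \<Rightarrow> real \<Rightarrow> real" where
  "radial_hessian k n u r =
     real_binom (n - 1) (k - 1) * rpow (deriv u r / r) (k - 1) *
       (deriv (deriv u) r + (n - k) / k * (deriv u r / r))"

text \<open>
  Only the restriction of \<open>u\<close> to the open interval \<open>(0,1)\<close> is relevant; the boundary values are
  one-sided limits.
\<close>
definition radial_eigenpair :: "real \<Rightarrow> real \<Rightarrow> (real \<Rightarrow> real) \<Rightarrow> real \<Rightarrow> bool" where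
  "radial_eigenpair k n u l \<longleftrightarrow>
     alpha_convex (n / k) u \<and> l > 0 \<and>
     (\<forall>r\<in>{0<..<1}. radial_hessian k n u r = rpow (- l * u r) k) \<and>
     (u \<longlongrightarrow> -1) (at_right 0) \<and> (u \<longlongrightarrow> 0) (at_left 1)"

definition radial_eigenvalue :: "real \<Rightarrow> real \<Rightarrow> real" where
  "radial_eigenvalue k n = (THE l. \<exists>u. radial_eigenpair k n u l)"

definition limit_expr :: "real \<Rightarrow> real" where
  "limit_expr \<alpha> =
     \<alpha> powr (\<alpha> + 1) / (\<alpha> - 1) powr (\<alpha> - 1) * (2 / \<alpha>) powr (2 / (2 - \<alpha>))"

definition limit_value :: "real \<Rightarrow> real" where
  "limit_value \<alpha> =
     (if \<alpha> = 1 then 4 else if \<alpha> = 2 then 8 * exp 1 else limit_expr \<alpha>)"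

lemma limit_expr_tendsto_1: "(limit_expr \<longlongrightarrow> 4) (at_right 1)"
proof -
  have "exp (ln 2 * 2) = (2 :: real) powr 2" by (simp add: powr_def mult.commute)
  then have "exp (ln 2 * 2) = (4 :: real)" by simp
  then show ?thesis unfolding limit_expr_def by real_asymp
qed

lemma limit_expr_tendsto_2: "(limit_expr \<longlongrightarrow> 8 * exp 1) (at 2)"
proof -
  have "exp (ln 2 * 3) = (2 :: real) powr 3" by (simp add: powr_def mult.commute)
  then have "exp (ln 2 * 3) = (8 :: real)" by simp
  then show ?thesis unfolding limit_expr_def by real_asymp
qed

end

theory Submission imports Defs begin

text \<open>
  Put \<open>a = n/k\<close> and \<open>c = binom (n - 1) (k - 1)\<close>. For an eigenpair \<open>(u, \<lambda>)\<close> the function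
  \<open>y = u' / (- r u)\<close> solves the Riccati equation \<open>r y' = y ((M/y)\<^sup>k - a + r\<^sup>2 y)\<close> with
  \<open>M = \<lambda> / c\<^bsup>1/k\<^esup>\<close>; it is bounded near \<open>0\<close> and blows up at \<open>1\<close>. For large \<open>k\<close> the forcing term
  \<open>(M/y)\<^sup>k\<close> acts as an obstacle that keeps \<open>y\<close> above \<open>M\<close> and is negligible above it, where \<open>z = 1/y\<close>
  satisfies the linear equation \<open>r z' = a z - r\<^sup>2\<close> with \<open>z(1) = 0\<close>, so that
  \<open>z = G\<^sub>a(r) = r\<^sup>a \<integral>\<^sub>r\<^sup>1 s\<^bsup>1-a\<^esup> ds\<close>. Making both halves quantitative gives \<open>a\<^bsup>1/k\<^esup> / M \<ge> max G\<^sub>a\<close> and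
  \<open>1 / ((1 + \<eta>) M) \<le> max G\<^sub>b\<close> for \<open>b = a - (1 + \<eta>)\<^bsup>-k\<^esup>\<close>, hence \<open>1/M \<rightarrow> max G\<^sub>\<alpha>\<close>. The limit of
  \<open>c\<^bsup>1/k\<^esup>\<close> follows from a crude Stirling estimate.

  Two solutions of the Riccati equation that are bounded near \<open>0\<close> are ordered like their rates \<open>M\<close>, and
  a dilation rescales \<open>M\<close>; so the rate at which the blow-up happens exactly at \<open>1\<close> is unique. For
  existence, the integrated equation is a Volterra equation whose nonlinearity is an \<open>L\<^sup>k\<close>-mean, hence
  Lipschitz in the supremum norm, and the weight \<open>exp(r\<^sup>2)\<close> turns it into a contraction on all of
  \<open>[0, \<infinity>)\<close>. Its solution must reach zero, since the upper bound on \<open>M\<close> bounds the radius on which it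
  is positive.
\<close>

section \<open>Sign and boundary behaviour of differentiable functions\<close>

lemma first_zero:
  fixes f :: "real \<Rightarrow> real"
  assumes cont: "continuous_on {a..b} f" and "a \<le> b" and start: "f a > 0" and stop: "f b \<le> 0"
  obtains c where "a < c" "c \<le> b" "f c = 0" "\<And>x. a \<le> x \<Longrightarrow> x < c \<Longrightarrow> f x > 0"
proof -
  define Z where "Z = {x \<in> {a..b}. f x = 0}"
  have zero_below: "\<exists>z\<in>Z. z \<le> x" if "a \<le> x" "x \<le> b" "f x \<le> 0" for x
    using IVT2'[of f x 0 a] that start continuous_on_subset[OF cont, of "{a..x}"]
    by (auto simp: Z_def)
  then have nonempty: "Z \<noteq> {}" using stop \<open>a \<le> b\<close> by blast
  have bdd: "bdd_below Z" by (auto simp: Z_def)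
  have "closed Z"
    unfolding Z_def using cont by (intro continuous_closed_preimage_constant) auto
  then have Inf: "Inf Z \<in> Z" using nonempty bdd by (intro closed_contains_Inf)
  show thesis
  proof
    show "a < Inf Z" using Inf start by (auto simp: Z_def less_le)
    show "Inf Z \<le> b" "f (Inf Z) = 0" using Inf by (auto simp: Z_def)
    fix x assume x_range: "a \<le> x" "x < Inf Z"
    show "f x > 0"
    proof (rule ccontr)
      assume "\<not> f x > 0"
      then obtain z where "z \<in> Z" "z \<le> x"
        using zero_below[of x] x_range \<open>Inf Z \<le> b\<close> by auto
      then show False using cInf_lower[OF _ bdd, of z] x_range by simp
    qed
  qed
qed

lemma DERIV_pos_at_zeros_imp_pos:
  fixes f :: "real \<Rightarrow> real"
  assumes pos_near_a: "eventually (\<lambda>x. f x > 0) (at_right a)"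
    and cont: "\<And>x. a < x \<Longrightarrow> x < b \<Longrightarrow> isCont f x"
    and deriv: "\<And>x. a < x \<Longrightarrow> x < b \<Longrightarrow> f x = 0 \<Longrightarrow> \<exists>D>0. (f has_real_derivative D) (at x)"
    and r_range: "a < r" "r < b"
  shows "f r > 0"
proof (rule ccontr)
  assume "\<not> f r > 0"
  then have "f r \<le> 0" by simp
  have "eventually (\<lambda>x. a < x \<and> x < r \<and> f x > 0) (at_right a)"
    using pos_near_a eventually_at_right_real[OF r_range(1)] by eventually_elim simp
  then obtain s where start: "a < s" "s < r" "f s > 0"
    using eventually_happens' trivial_limit_at_right_real by blast
  have "continuous_on {s..r} f"
    using start r_range by (intro continuous_at_imp_continuous_on ballI cont) auto
  then obtain c where first: "s < c" "c \<le> r" "f c = 0" and pos: "\<And>x. s \<le> x \<Longrightarrow> x < c \<Longrightarrow> f x > 0"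
    using first_zero[OF _ less_imp_le[OF start(2)] start(3) \<open>f r \<le> 0\<close>] by blast
  then obtain D where "D > 0" "(f has_real_derivative D) (at c)"
    using deriv[of c] start r_range by auto
  then obtain d where "d > 0" and increasing: "\<And>h. 0 < h \<Longrightarrow> h < d \<Longrightarrow> f (c - h) < f c"
    using DERIV_pos_inc_left by blast
  define h where "h = min (d / 2) (c - s)"
  have "0 < h" "h < d" "s \<le> c - h" using \<open>d > 0\<close> first(1) by (auto simp: h_def)
  then show False using increasing[of h] pos[of "c - h"] first(3) by simp
qed

lemma DERIV_nonneg_imp_ge_at_right_limit:
  fixes f g :: "real \<Rightarrow> real"
  assumes deriv: "\<And>x. a < x \<Longrightarrow> x < b \<Longrightarrow> \<exists>D. (f has_real_derivative D) (at x) \<and> 0 \<le> D"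
    and lower: "\<And>x. a < x \<Longrightarrow> x < b \<Longrightarrow> g x \<le> f x"
    and lim: "(g \<longlongrightarrow> L) (at_right a)" and r_range: "a < r" "r < b"
  shows "L \<le> f r"
proof (rule tendsto_upperbound[OF lim])
  have "g x \<le> f r" if x_range: "a < x" "x < r" for x
  proof -
    have "f x \<le> f r"
      using x_range r_range by (intro DERIV_nonneg_imp_nondecreasing[of x r f] deriv) auto
    then show ?thesis using lower[of x] x_range r_range by linarith
  qed
  then show "eventually (\<lambda>x. g x \<le> f r) (at_right a)"
    using r_range by (auto simp: eventually_at_right_field)
qed simp

lemma DERIV_nonpos_imp_ge_at_left_limit:
  fixes f g :: "real \<Rightarrow> real"
  assumes deriv: "\<And>x. a < x \<Longrightarrow> x < b \<Longrightarrow> \<exists>D. (f has_real_derivative D) (at x) \<and> D \<le> 0"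
    and lower: "\<And>x. a < x \<Longrightarrow> x < b \<Longrightarrow> g x \<le> f x"
    and lim: "(g \<longlongrightarrow> L) (at_left b)" and r_range: "a < r" "r < b"
  shows "L \<le> f r"
proof (rule tendsto_upperbound[OF lim])
  have "g x \<le> f r" if x_range: "r < x" "x < b" for x
  proof -
    have "f x \<le> f r"
      using x_range r_range by (intro DERIV_nonpos_imp_nonincreasing[of r x f] deriv) auto
    then show ?thesis using lower[of x] x_range r_range by linarith
  qed
  then show "eventually (\<lambda>x. g x \<le> f r) (at_left b)"
    using r_range by (auto simp: eventually_at_left_field)
qed simp

section \<open>The maximum of the obstacle profile\<close>

definition powr_primitive :: "real \<Rightarrow> real \<Rightarrow> real" where
  "powr_primitive b r = (if b = 2 then ln r else (r powr (2 - b) - 1) / (2 - b))"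

text \<open>The obstacle profile \<open>- r\<^sup>b powr_primitive b r\<close> has its maximum at the critical radius, and the
  critical rate is the reciprocal of that maximum.\<close>

definition critical_exponent :: "real \<Rightarrow> real" where
  "critical_exponent b = (if b = 2 then 1 / 2 else ln (2 / b) / (2 - b))"

definition critical_radius :: "real \<Rightarrow> real" where
  "critical_radius b = exp (- critical_exponent b)"

definition critical_rate :: "real \<Rightarrow> real" where
  "critical_rate b = b / (critical_radius b)\<^sup>2"

lemma powr_primitive_1 [simp]: "powr_primitive b 1 = 0"
  by (simp add: powr_primitive_def)

lemma DERIV_powr_primitive:
  assumes "r > 0"
  shows "(powr_primitive b has_real_derivative r powr (1 - b)) (at r)"
proof (cases "b = 2")
  case True
  have "(ln has_real_derivative r powr (1 - b)) (at r)"
    using assms True by (auto intro!: derivative_eq_intros simp: powr_minus divide_simps)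
  moreover have "powr_primitive b = ln" using True by (auto simp: powr_primitive_def)
  ultimately show ?thesis by simp
next
  case False
  have "((\<lambda>r. (r powr (2 - b) - 1) / (2 - b)) has_real_derivative r powr (1 - b)) (at r)"
    using assms False by (auto intro!: derivative_eq_intros)
  moreover have "powr_primitive b = (\<lambda>r. (r powr (2 - b) - 1) / (2 - b))"
    using False by (auto simp: powr_primitive_def)
  ultimately show ?thesis by simp
qed

lemma powr_primitive_tendsto_at_left_1: "(powr_primitive b \<longlongrightarrow> 0) (at_left 1)"
  using DERIV_isCont[OF DERIV_powr_primitive[of 1 b]]
  by (auto simp: isCont_def intro: tendsto_within_subset)

lemma powr_mult_powr_primitive_tendsto_0:
  assumes "b > 0"
  shows "((\<lambda>r. r powr b * powr_primitive b r) \<longlongrightarrow> 0) (at_right 0)"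
proof (cases "b = 2")
  case True
  have "((\<lambda>r::real. r powr 2 * ln r) \<longlongrightarrow> 0) (at_right 0)" by real_asymp
  then show ?thesis using True by (simp add: powr_primitive_def)
next
  case False
  have "((\<lambda>r. (r powr 2 - r powr b) / (2 - b)) \<longlongrightarrow> (0 powr 2 - 0 powr b) / (2 - b)) (at_right 0)"
    using assms False by (intro tendsto_intros) (auto simp: eventually_at_filter)
  then have "((\<lambda>r. (r powr 2 - r powr b) / (2 - b)) \<longlongrightarrow> 0) (at_right 0)" by simp
  moreover have "(r powr 2 - r powr b) / (2 - b) = r powr b * powr_primitive b r" for r :: real
    using False
    by (simp add: powr_primitive_def right_diff_distrib powr_add[symmetric] del: powr_numeral)
  ultimately show ?thesis by simp
qed

lemma critical_exponent_pos:
  assumes "b > 0"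
  shows "critical_exponent b > 0"
proof -
  consider (equal) "b = 2" | (less) "b < 2" | (greater) "b > 2" by linarith
  then show ?thesis
  proof cases
    case less
    then have "ln (2 / b) > 0" using assms by simp
    then show ?thesis using less by (simp add: critical_exponent_def)
  next
    case greater
    then have "ln (2 / b) < 0" using assms by simp
    then show ?thesis using greater by (simp add: critical_exponent_def divide_neg_neg)
  qed (simp add: critical_exponent_def)
qed

lemma critical_radius_pos: "critical_radius b > 0"
  by (simp add: critical_radius_def)

lemma critical_radius_less_1: "b > 0 \<Longrightarrow> critical_radius b < 1"
  by (simp add: critical_radius_def critical_exponent_pos)

lemma critical_rate_pos: "b > 0 \<Longrightarrow> critical_rate b > 0"
  using critical_radius_pos[of b] by (simp add: critical_rate_def)

lemma critical_rate_eq_exp: "critical_rate b = b * exp (2 * critical_exponent b)"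
  by (simp add: critical_rate_def critical_radius_def exp_minus exp_double divide_inverse
      power_inverse)

lemma isCont_critical_exponent:
  assumes "b > 0"
  shows "isCont critical_exponent b"
proof (cases "b = 2")
  case True
  have "((\<lambda>b::real. ln (2 / b) / (2 - b)) \<longlongrightarrow> 1 / 2) (at 2)" by real_asymp
  moreover have "eventually (\<lambda>b. ln (2 / b) / (2 - b) = critical_exponent b) (at 2)"
    by (auto simp: critical_exponent_def eventually_at_filter)
  ultimately have "(critical_exponent \<longlongrightarrow> 1 / 2) (at 2)"
    by (rule Lim_transform_eventually)
  then show ?thesis using True by (simp add: isCont_def critical_exponent_def)
next
  case False
  have "isCont (\<lambda>b. ln (2 / b) / (2 - b)) b"
    using assms False by (intro continuous_intros) auto
  moreover have "eventually (\<lambda>x. critical_exponent x = ln (2 / x) / (2 - x)) (nhds b)"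
    using t1_space_nhds[OF False] by eventually_elim (auto simp: critical_exponent_def)
  ultimately show ?thesis by (simp add: isCont_cong)
qed

lemma isCont_critical_rate:
  assumes "b > 0"
  shows "isCont critical_rate b"
  unfolding critical_rate_def critical_radius_def
  using isCont_critical_exponent[OF assms] by (intro continuous_intros) auto

lemma critical_radius_powr:
  assumes "b > 0"
  shows "critical_radius b powr (2 - b) = b / 2"
proof (cases "b = 2")
  case False
  have "critical_radius b powr (2 - b) = exp (- ln (2 / b))"
    using False by (simp add: critical_radius_def critical_exponent_def powr_def)
  also have "\<dots> = b / 2" using assms by (simp add: exp_minus)
  finally show ?thesis .
qed (simp add: critical_radius_def)

lemma powr_primitive_critical_radius:
  assumes "b > 0"
  shows "powr_primitive b (critical_radius b) = - 1 / 2"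
proof (cases "b = 2")
  case True
  then show ?thesis
    by (simp add: powr_primitive_def critical_radius_def critical_exponent_def)
next
  case False
  then show ?thesis
    using critical_radius_powr[OF assms] by (simp add: powr_primitive_def field_simps)
qed

definition obstacle_gap :: "real \<Rightarrow> real \<Rightarrow> real" where
  "obstacle_gap b r = r powr - b / critical_rate b + powr_primitive b r"

lemma obstacle_gap_critical_radius:
  assumes "b > 0"
  shows "obstacle_gap b (critical_radius b) = 0"
proof -
  let ?R = "critical_radius b"
  have R_pos: "?R > 0" by (rule critical_radius_pos)
  have "?R\<^sup>2 * ?R powr - b = ?R powr (2 - b)"
    using R_pos by (simp add: powr_diff powr_minus divide_inverse)
  then have "?R powr - b / critical_rate b = 1 / 2"
    using critical_radius_powr[OF assms] assms R_pos by (simp add: critical_rate_def mult.commute)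
  then show ?thesis
    using powr_primitive_critical_radius[OF assms] unfolding obstacle_gap_def by linarith
qed

lemma DERIV_obstacle_gap:
  assumes "b > 0" "r > 0"
  shows "(obstacle_gap b has_real_derivative
    r powr (- b - 1) * (r\<^sup>2 - (critical_radius b)\<^sup>2)) (at r)"
proof -
  have "(obstacle_gap b has_real_derivative
      - b * r powr (- b - 1) / critical_rate b + r powr (1 - b)) (at r)"
    unfolding obstacle_gap_def[abs_def] using assms critical_rate_pos[OF assms(1)]
    by (auto intro!: derivative_eq_intros DERIV_powr_primitive)
  moreover have "r powr (1 - b) = r powr (- b - 1) * r\<^sup>2"
    using assms powr_add[of r "- b - 1" 2] by simp
  ultimately show ?thesis
    using assms critical_radius_pos[of b] by (simp add: critical_rate_def field_simps)
qed

lemma obstacle_gap_nonneg: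
  assumes "b > 0" "r > 0"
  shows "obstacle_gap b r \<ge> 0"
proof -
  let ?R = "critical_radius b"
  have "obstacle_gap b ?R \<le> obstacle_gap b r"
  proof (cases "?R \<le> r")
    case True
    have "\<exists>D. (obstacle_gap b has_real_derivative D) (at s) \<and> 0 \<le> D" if "?R \<le> s" for s
      using DERIV_obstacle_gap[OF assms(1), of s] power_mono[OF that, of 2]
        critical_radius_pos[of b] that
      by (intro exI conjI) auto
    then show ?thesis using DERIV_nonneg_imp_nondecreasing[OF True] by blast
  next
    case False
    have "\<exists>D. (obstacle_gap b has_real_derivative D) (at s) \<and> D \<le> 0" if "r \<le> s" "s \<le> ?R" for s
      using DERIV_obstacle_gap[OF assms(1), of s] power_mono[OF that(2), of 2] assms(2) that
      by (intro exI conjI) (auto intro!: mult_nonneg_nonpos)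
    then show ?thesis using DERIV_nonpos_imp_nonincreasing[of r ?R "obstacle_gap b"] False by simp
  qed
  then show ?thesis by (simp add: obstacle_gap_critical_radius[OF assms(1)])
qed

section \<open>The Riccati equation\<close>

locale riccati_solution =
  fixes k a M :: real and y :: "real \<Rightarrow> real"
  assumes k_pos: "k > 0" and a_pos: "a > 0" and M_pos: "M > 0"
    and pos: "\<And>r. 0 < r \<Longrightarrow> r < 1 \<Longrightarrow> y r > 0"
    and DERIV: "\<And>r. 0 < r \<Longrightarrow> r < 1 \<Longrightarrow>
      (y has_real_derivative y r * ((M / y r) powr k - a + r\<^sup>2 * y r) / r) (at r)"

text \<open>Constant along the solutions of \<open>r y' = y (r\<^sup>2 y - b)\<close>, the Riccati equation without forcing.\<close>

definition riccati_potential :: "real \<Rightarrow> (real \<Rightarrow> real) \<Rightarrow> real \<Rightarrow> real" where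
  "riccati_potential b y r = r powr - b / y r + powr_primitive b r"

context riccati_solution
begin

lemma isCont_solution: "0 < r \<Longrightarrow> r < 1 \<Longrightarrow> isCont y r"
  using DERIV by (rule DERIV_isCont)

lemma DERIV_weighted_powr:
  assumes r_range: "0 < r" "r < 1"
  shows "((\<lambda>r. r powr (a * k) * y r powr k) has_real_derivative
    k * r powr (a * k - 1) * (M powr k + r\<^sup>2 * y r powr (k + 1))) (at r)"
proof -
  let ?y' = "y r * ((M / y r) powr k - a + r\<^sup>2 * y r) / r"
  have y_pos: "y r > 0" by (rule pos[OF r_range])
  have "((\<lambda>r. r powr (a * k) * y r powr k) has_real_derivative
      a * k * r powr (a * k - 1) * y r powr k + k * y r powr (k - 1) * ?y' * r powr (a * k)) (at r)"
    by (rule derivative_eq_intros DERIV_fun_powr DERIV refl | use r_range y_pos in simp)+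
  moreover have "a * k * r powr (a * k - 1) * y r powr k
        + k * y r powr (k - 1) * ?y' * r powr (a * k) =
      k * r powr (a * k - 1) * (M powr k + r\<^sup>2 * y r powr (k + 1))"
  proof -
    have weight: "r powr (a * k) = r powr (a * k - 1) * r"
      using r_range by (simp add: powr_diff)
    have chain: "k * y r powr (k - 1) * ?y' =
        k * ((M powr k - a * y r powr k + r\<^sup>2 * y r powr (k + 1)) / r)"
      using r_range y_pos M_pos
      by (simp add: powr_diff powr_add powr_divide field_simps power2_eq_square)
    show ?thesis unfolding weight chain using r_range by (simp add: field_simps)
  qed
  ultimately show ?thesis by (rule DERIV_cong)
qed

lemma rate_le_mult_solution:
  assumes r_range: "0 < r" "r < 1"
  shows "M \<le> a powr (1 / k) * y r"
proof -
  let ?f = "\<lambda>r. a * (r powr (a * k) * y r powr k) - M powr k * r powr (a * k)"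
  have "0 \<le> ?f r"
  proof (rule DERIV_nonneg_imp_ge_at_right_limit[OF _ _ _ r_range])
    fix x :: real assume x_range: "0 < x" "x < 1"
    have "(?f has_real_derivative a * (k * x powr (a * k - 1) * (M powr k + x\<^sup>2 * y x powr (k + 1)))
        - M powr k * (a * k * x powr (a * k - 1))) (at x)"
      using x_range by (intro DERIV_diff DERIV_cmult DERIV_weighted_powr has_real_derivative_powr)
    moreover have "0 \<le> a * k * x powr (a * k - 1) * (x\<^sup>2 * y x powr (k + 1))"
      using a_pos k_pos by simp
    ultimately show "\<exists>D. (?f has_real_derivative D) (at x) \<and> 0 \<le> D"
      by (intro exI conjI) (assumption, simp add: algebra_simps)
    show "- (M powr k * x powr (a * k)) \<le> ?f x" using a_pos by simp
  next
    have "((\<lambda>x. - (M powr k * x powr (a * k))) \<longlongrightarrow> - (M powr k * 0 powr (a * k))) (at_right 0)"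
      using a_pos k_pos by (intro tendsto_intros) (auto simp: eventually_at_filter)
    then show "((\<lambda>x. - (M powr k * x powr (a * k))) \<longlongrightarrow> 0) (at_right 0)" by simp
  qed
  then have "r powr (a * k) * M powr k \<le> r powr (a * k) * (a * y r powr k)"
    by (simp add: mult.assoc mult.commute mult.left_commute)
  then have "M powr k \<le> a * y r powr k" using r_range by simp
  then have "(M powr k) powr (1 / k) \<le> (a * y r powr k) powr (1 / k)"
    using k_pos by (intro powr_mono2) auto
  then show ?thesis using M_pos k_pos a_pos pos[OF r_range] by (simp add: powr_mult powr_powr)
qed

lemma DERIV_riccati_potential:
  assumes r_range: "0 < r" "r < 1"
  shows "(riccati_potential b y has_real_derivative
    r powr (- b - 1) * (a - b - (M / y r) powr k) / y r) (at r)"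
proof -
  let ?y' = "y r * ((M / y r) powr k - a + r\<^sup>2 * y r) / r"
  have y_pos: "y r > 0" by (rule pos[OF r_range])
  have "(riccati_potential b y has_real_derivative
      (- b * r powr (- b - 1) * y r - r powr - b * ?y') / (y r * y r) + r powr (1 - b)) (at r)"
    unfolding riccati_potential_def[abs_def] using r_range y_pos
    by (auto intro!: derivative_eq_intros DERIV_powr_primitive DERIV)
  moreover have "r powr - b = r powr (- b - 1) * r" "r powr (1 - b) = r powr (- b - 1) * r\<^sup>2"
    using r_range powr_add[of r "- b - 1" 1] powr_add[of r "- b - 1" 2] by simp_all
  ultimately show ?thesis
    using r_range y_pos by (elim DERIV_cong) (simp add: field_simps power2_eq_square)
qed

lemma riccati_potential_nonneg:
  assumes "0 < r" "r < 1"
  shows "riccati_potential a y r \<ge> 0"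
proof (rule DERIV_nonpos_imp_ge_at_left_limit[OF _ _ powr_primitive_tendsto_at_left_1 assms])
  fix x :: real assume x_range: "0 < x" "x < 1"
  show "powr_primitive a x \<le> riccati_potential a y x"
    using pos[OF x_range] by (simp add: riccati_potential_def)
  have "x powr (- a - 1) * (a - a - (M / y x) powr k) / y x \<le> 0"
    using pos[OF x_range] by (simp add: divide_nonneg_pos)
  then show "\<exists>D. (riccati_potential a y has_real_derivative D) (at x) \<and> D \<le> 0"
    using DERIV_riccati_potential[OF x_range] by blast
qed

theorem rate_le_critical_rate: "M \<le> a powr (1 / k) * critical_rate a"
proof -
  let ?R = "critical_radius a"
  have R_range: "0 < ?R" "?R < 1" using critical_radius_pos critical_radius_less_1 a_pos by auto
  have "?R powr - a / critical_rate a \<le> ?R powr - a / y ?R"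
    using riccati_potential_nonneg[OF R_range] obstacle_gap_critical_radius[OF a_pos]
    by (simp add: riccati_potential_def obstacle_gap_def)
  then have "y ?R \<le> critical_rate a"
    using R_range pos[OF R_range] critical_rate_pos[OF a_pos] by (simp add: field_simps)
  then have "a powr (1 / k) * y ?R \<le> a powr (1 / k) * critical_rate a"
    by (intro mult_left_mono) auto
  with rate_le_mult_solution[OF R_range] show ?thesis by linarith
qed

lemma riccati_potential_pos_near_0:
  assumes "b > 0" "Bfun y (at_right 0)"
  shows "eventually (\<lambda>r. riccati_potential b y r > 0) (at_right 0)"
proof -
  obtain B where "B > 0" and bounded: "eventually (\<lambda>r. norm (y r) \<le> B) (at_right 0)"
    using assms(2) by (rule BfunE)
  have "eventually (\<lambda>r. - (1 / B) < r powr b * powr_primitive b r) (at_right 0)"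
    using \<open>B > 0\<close> by (intro order_tendstoD[OF powr_mult_powr_primitive_tendsto_0] assms) simp
  moreover have "eventually (\<lambda>r. r \<in> {0<..<1}) (at_right (0 :: real))"
    by (rule eventually_at_right_real) simp
  ultimately show ?thesis
    using bounded
  proof eventually_elim
    case (elim r)
    then have "1 / B \<le> 1 / y r" using pos[of r] by (simp add: frac_le)
    then have "0 < 1 / y r + r powr b * powr_primitive b r" using elim by linarith
    also have "\<dots> = r powr b * riccati_potential b y r"
      using elim powr_add[of r b "- b"]
      by (simp add: riccati_potential_def distrib_left)
    finally show ?case using elim by (simp add: zero_less_mult_iff)
  qed
qed

lemma riccati_potential_tendsto_at_left_1:
  assumes "filterlim y at_top (at_left 1)"
  shows "(riccati_potential b y \<longlongrightarrow> 0) (at_left 1)"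
proof -
  have "((\<lambda>r. r powr - b * inverse (y r) + powr_primitive b r) \<longlongrightarrow> 1 powr - b * 0 + 0) (at_left 1)"
    by (intro tendsto_intros powr_primitive_tendsto_at_left_1 tendsto_inverse_0_at_top assms) auto
  then show ?thesis by (simp add: riccati_potential_def[abs_def] divide_inverse)
qed

lemma DERIV_riccati_potential_pos:
  assumes r_range: "0 < r" "r < 1" and "m > 0" "m < y r" and b_eq: "b = a - (M / m) powr k"
  shows "\<exists>D>0. (riccati_potential b y has_real_derivative D) (at r)"
proof -
  have "M / y r < M / m" using assms M_pos by (intro divide_strict_left_mono) auto
  then have "(M / y r) powr k < (M / m) powr k"
    using k_pos M_pos pos[OF r_range] by (intro powr_less_mono2) auto
  then have "r powr (- b - 1) * (a - b - (M / y r) powr k) / y r > 0"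
    using b_eq r_range pos[OF r_range] by simp
  then show ?thesis using DERIV_riccati_potential[OF r_range] by blast
qed

lemma above_threshold_at_potential_zero:
  assumes r_range: "0 < r" "r < 1" and "b > 0" "m < critical_rate b" "riccati_potential b y r = 0"
  shows "m < y r"
proof (rule ccontr)
  assume "\<not> m < y r"
  then have "1 / critical_rate b < 1 / y r"
    using assms pos[OF r_range] by (simp add: frac_less2)
  then have "r powr - b / critical_rate b < r powr - b / y r"
    using r_range mult_strict_left_mono[of "1 / critical_rate b" "1 / y r" "r powr - b"] by simp
  then show False
    using obstacle_gap_nonneg[OF \<open>b > 0\<close> r_range(1)] assms(5)
    by (simp add: riccati_potential_def obstacle_gap_def)
qed

lemma riccati_potential_pos:
  assumes r_range: "0 < r" "r < 1" and m_range: "0 < m" "m < critical_rate b"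
    and b_eq: "b = a - (M / m) powr k" "b > 0" and bounded: "Bfun y (at_right 0)"
  shows "riccati_potential b y r > 0"
proof (rule DERIV_pos_at_zeros_imp_pos[OF _ _ _ r_range])
  show "eventually (\<lambda>r. riccati_potential b y r > 0) (at_right 0)"
    by (rule riccati_potential_pos_near_0[OF b_eq(2) bounded])
  fix x :: real assume x_range: "0 < x" "x < 1"
  show "isCont (riccati_potential b y) x"
    using DERIV_riccati_potential[OF x_range] by (rule DERIV_isCont)
  assume "riccati_potential b y x = 0"
  then have "m < y x"
    by (rule above_threshold_at_potential_zero[OF x_range b_eq(2) m_range(2)])
  then show "\<exists>D>0. (riccati_potential b y has_real_derivative D) (at x)"
    by (rule DERIV_riccati_potential_pos[OF x_range m_range(1) _ b_eq(1)])
qed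

text \<open>If \<open>m < critical_rate b\<close>, the potential would be positive on the whole interval and increasing
  near the blow-up point, where it vanishes.\<close>

theorem critical_rate_le_threshold:
  assumes "m > 0" and b_eq: "b = a - (M / m) powr k" "b > 0"
    and bounded: "Bfun y (at_right 0)" and blowup: "filterlim y at_top (at_left 1)"
  shows "critical_rate b \<le> m"
proof (rule ccontr)
  assume "\<not> critical_rate b \<le> m"
  then have m_range: "0 < m" "m < critical_rate b" using \<open>m > 0\<close> by auto
  obtain c where "c < 1" and above: "\<And>r. c < r \<Longrightarrow> r < 1 \<Longrightarrow> m < y r"
    using blowup by (auto simp: filterlim_at_top_dense eventually_at_left_field)
  define s where "s = max c 0"
  define r where "r = (s + 1) / 2"
  have r_range: "s < r" "r < 1" using \<open>c < 1\<close> by (auto simp: r_def s_def)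
  have "0 \<le> - riccati_potential b y r"
  proof (rule DERIV_nonpos_imp_ge_at_left_limit[OF _ order_refl _ r_range])
    show "((\<lambda>r. - riccati_potential b y r) \<longlongrightarrow> 0) (at_left 1)"
      using tendsto_minus[OF riccati_potential_tendsto_at_left_1[OF blowup]] by simp
    fix x assume "s < x" "x < 1"
    then obtain D where "D > 0" "(riccati_potential b y has_real_derivative D) (at x)"
      using DERIV_riccati_potential_pos[of x m b] above[of x] m_range b_eq by (auto simp: s_def)
    then show "\<exists>D. ((\<lambda>r. - riccati_potential b y r) has_real_derivative D) (at x) \<and> D \<le> 0"
      using DERIV_minus by (intro exI[of _ "- D"]) auto
  qed
  then show False
    using riccati_potential_pos[OF _ r_range(2) m_range b_eq bounded] r_range by (simp add: s_def)
qed

end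

locale riccati_comparison =
  slow: riccati_solution k a M\<^sub>1 y\<^sub>1 + fast: riccati_solution k a M\<^sub>2 y\<^sub>2
  for k a M\<^sub>1 M\<^sub>2 :: real and y\<^sub>1 y\<^sub>2 :: "real \<Rightarrow> real" +
  assumes rate_less: "M\<^sub>1 < M\<^sub>2" and bounded: "Bfun y\<^sub>1 (at_right 0)"
begin

definition powr_gap :: "real \<Rightarrow> real" where
  "powr_gap r = r powr (a * k) * y\<^sub>2 r powr k - r powr (a * k) * y\<^sub>1 r powr k"

lemma rate_powr_less: "M\<^sub>1 powr k < M\<^sub>2 powr k"
  using slow.M_pos slow.k_pos rate_less by (intro powr_less_mono2) auto

lemma DERIV_powr_gap:
  assumes "0 < r" "r < 1"
  shows "(powr_gap has_real_derivative k * r powr (a * k - 1) *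
    ((M\<^sub>2 powr k - M\<^sub>1 powr k) + r\<^sup>2 * (y\<^sub>2 r powr (k + 1) - y\<^sub>1 r powr (k + 1)))) (at r)"
  unfolding powr_gap_def[abs_def]
  by (rule DERIV_cong[OF DERIV_diff[OF fast.DERIV_weighted_powr slow.DERIV_weighted_powr]])
    (use assms in \<open>auto simp: algebra_simps\<close>)

lemma powr_gap_increasing_near_0:
  "eventually (\<lambda>r. \<exists>D>0. (powr_gap has_real_derivative D) (at r)) (at_right 0)"
proof -
  obtain B where "eventually (\<lambda>r. norm (y\<^sub>1 r) \<le> B) (at_right 0)"
    using bounded by (rule BfunE)
  moreover have "eventually (\<lambda>r. r\<^sup>2 * B powr (k + 1) < M\<^sub>2 powr k - M\<^sub>1 powr k) (at_right 0)"
    using rate_powr_less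
    by (intro order_tendstoD(2)[where y = "0\<^sup>2 * B powr (k + 1)"] tendsto_intros) auto
  moreover have "eventually (\<lambda>r. r \<in> {0<..<1}) (at_right (0 :: real))"
    by (rule eventually_at_right_real) simp
  ultimately show ?thesis
  proof eventually_elim
    case (elim r)
    then have r_range: "0 < r" "r < 1" by auto
    have "r\<^sup>2 * y\<^sub>1 r powr (k + 1) \<le> r\<^sup>2 * B powr (k + 1)"
      using elim slow.pos[OF r_range] slow.k_pos by (intro mult_left_mono powr_mono2) auto
    then have "0 < (M\<^sub>2 powr k - M\<^sub>1 powr k) - r\<^sup>2 * y\<^sub>1 r powr (k + 1)" using elim by linarith
    also have "\<dots> \<le> (M\<^sub>2 powr k - M\<^sub>1 powr k) + r\<^sup>2 * (y\<^sub>2 r powr (k + 1) - y\<^sub>1 r powr (k + 1))"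
      by (simp add: right_diff_distrib)
    finally have "0 < k * r powr (a * k - 1) *
        ((M\<^sub>2 powr k - M\<^sub>1 powr k) + r\<^sup>2 * (y\<^sub>2 r powr (k + 1) - y\<^sub>1 r powr (k + 1)))"
      using r_range slow.k_pos by simp
    then show ?case using DERIV_powr_gap[OF r_range] by blast
  qed
qed

lemma powr_gap_pos_near_0: "eventually (\<lambda>r. powr_gap r > 0) (at_right 0)"
proof -
  obtain B where "eventually (\<lambda>r. norm (y\<^sub>1 r) \<le> B) (at_right 0)"
    using bounded by (rule BfunE)
  from eventually_conj[OF this eventually_conj[OF powr_gap_increasing_near_0
        eventually_at_right_real[OF zero_less_one]]]
  obtain e where "e > 0" and near_0: "\<And>r. 0 < r \<Longrightarrow> r < e \<Longrightarrow>
      \<bar>y\<^sub>1 r\<bar> \<le> B \<and> (\<exists>D>0. (powr_gap has_real_derivative D) (at r)) \<and> r < 1"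
    unfolding eventually_at_right_field by auto
  have increasing: "\<exists>D. (powr_gap has_real_derivative D) (at r) \<and> 0 < D" if "0 < r" "r < e" for r
    using near_0[OF that] by blast
  have nonneg: "0 \<le> powr_gap r" if r_range: "0 < r" "r < e" for r
  proof (rule DERIV_nonneg_imp_ge_at_right_limit[OF _ _ _ r_range])
    fix x assume x_range: "0 < x" "x < e"
    show "\<exists>D. (powr_gap has_real_derivative D) (at x) \<and> 0 \<le> D"
      using increasing[OF x_range] less_imp_le by blast
    have "x powr (a * k) * y\<^sub>1 x powr k \<le> x powr (a * k) * B powr k"
      using near_0[OF x_range] slow.pos[of x] slow.k_pos x_range
      by (intro mult_left_mono powr_mono2) auto
    moreover have "0 \<le> x powr (a * k) * y\<^sub>2 x powr k" by simp
    ultimately show "- (x powr (a * k) * B powr k) \<le> powr_gap x"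
      unfolding powr_gap_def by linarith
  next
    have "((\<lambda>x. - (x powr (a * k) * B powr k)) \<longlongrightarrow> - (0 powr (a * k) * B powr k)) (at_right 0)"
      using slow.a_pos slow.k_pos by (intro tendsto_intros) (auto simp: eventually_at_filter)
    then show "((\<lambda>x. - (x powr (a * k) * B powr k)) \<longlongrightarrow> 0) (at_right 0)" by simp
  qed
  have "0 < powr_gap r" if r_range: "0 < r" "r < e" for r
  proof -
    have "powr_gap (r / 2) < powr_gap r"
      by (rule DERIV_pos_imp_increasing) (use r_range increasing in auto)
    then show ?thesis using nonneg[of "r / 2"] r_range by linarith
  qed
  then show ?thesis using \<open>e > 0\<close> by (auto simp: eventually_at_right_field)
qed

theorem solution_less:
  assumes r_range: "0 < r" "r < 1"
  shows "y\<^sub>1 r < y\<^sub>2 r"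
proof -
  have "powr_gap r > 0"
  proof (rule DERIV_pos_at_zeros_imp_pos[OF powr_gap_pos_near_0 _ _ r_range])
    fix x :: real assume x_range: "0 < x" "x < 1"
    show "isCont powr_gap x"
      using DERIV_powr_gap[OF x_range] by (rule DERIV_isCont)
    assume "powr_gap x = 0"
    then have "y\<^sub>1 x powr k = y\<^sub>2 x powr k" using x_range by (simp add: powr_gap_def)
    then have "y\<^sub>1 x = y\<^sub>2 x"
      using slow.pos[OF x_range] fast.pos[OF x_range] slow.k_pos
      by (metis less_irrefl less_imp_le linorder_neqE_linordered_idom powr_less_mono2)
    then show "\<exists>D>0. (powr_gap has_real_derivative D) (at x)"
      using DERIV_powr_gap[OF x_range] rate_powr_less slow.k_pos x_range
      by (intro exI conjI) auto
  qed
  then have "y\<^sub>1 r powr k < y\<^sub>2 r powr k" using r_range by (simp add: powr_gap_def)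
  then show ?thesis
    using powr_less_cancel2[OF slow.k_pos slow.pos[OF r_range] fast.pos[OF r_range]] by blast
qed

end

lemma riccati_solution_rescale:
  assumes "riccati_solution k a M y" and \<theta>_range: "0 < \<theta>" "\<theta> \<le> 1"
  shows "riccati_solution k a (\<theta>\<^sup>2 * M) (\<lambda>r. \<theta>\<^sup>2 * y (\<theta> * r))"
proof -
  interpret riccati_solution k a M y by fact
  show ?thesis
  proof
    show "k > 0" "a > 0" "\<theta>\<^sup>2 * M > 0" using k_pos a_pos M_pos \<theta>_range by auto
  next
    fix r :: real assume r_range: "0 < r" "r < 1"
    then have \<theta>r_range: "0 < \<theta> * r" "\<theta> * r < 1"
      using \<theta>_range mult_le_less_imp_less[of \<theta> 1 r 1] by auto
    show "0 < \<theta>\<^sup>2 * y (\<theta> * r)" using pos[OF \<theta>r_range] \<theta>_range by simp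
    let ?y' = "y (\<theta> * r) * ((M / y (\<theta> * r)) powr k - a + (\<theta> * r)\<^sup>2 * y (\<theta> * r)) / (\<theta> * r)"
    have "((\<lambda>r. \<theta>\<^sup>2 * y (\<theta> * r)) has_real_derivative \<theta>\<^sup>2 * (?y' * \<theta>)) (at r)"
      using DERIV[OF \<theta>r_range]
      by (intro DERIV_cmult DERIV_chain2[where f = y]) (auto intro!: derivative_eq_intros)
    moreover have "\<theta>\<^sup>2 * M / (\<theta>\<^sup>2 * y (\<theta> * r)) = M / y (\<theta> * r)"
      using \<theta>_range by simp
    moreover have "\<theta>\<^sup>2 * (Y * (X - a + (\<theta> * r)\<^sup>2 * Y) / (\<theta> * r) * \<theta>) =
        \<theta>\<^sup>2 * Y * (X - a + r\<^sup>2 * (\<theta>\<^sup>2 * Y)) / r" for X Y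
      using \<theta>_range r_range by (simp add: power_mult_distrib mult_ac)
    ultimately show "((\<lambda>r. \<theta>\<^sup>2 * y (\<theta> * r)) has_real_derivative \<theta>\<^sup>2 * y (\<theta> * r) *
        ((\<theta>\<^sup>2 * M / (\<theta>\<^sup>2 * y (\<theta> * r))) powr k - a + r\<^sup>2 * (\<theta>\<^sup>2 * y (\<theta> * r))) / r) (at r)"
      by (simp only:)
  qed
qed

lemma riccati_rate_le_blowup_rate:
  assumes slow: "riccati_solution k a M\<^sub>1 y\<^sub>1" "Bfun y\<^sub>1 (at_right 0)"
      "filterlim y\<^sub>1 at_top (at_left 1)"
    and fast: "riccati_solution k a M\<^sub>2 y\<^sub>2"
  shows "M\<^sub>2 \<le> M\<^sub>1"
proof (rule ccontr)
  assume "\<not> M\<^sub>2 \<le> M\<^sub>1"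
  define \<theta> where "\<theta> = sqrt ((M\<^sub>1 + M\<^sub>2) / (2 * M\<^sub>2))"
  have "0 < M\<^sub>1" "0 < M\<^sub>2" using slow(1) fast by (auto simp: riccati_solution_def)
  then have \<theta>_range: "0 < \<theta>" "\<theta> < 1" "M\<^sub>1 < \<theta>\<^sup>2 * M\<^sub>2"
    using \<open>\<not> M\<^sub>2 \<le> M\<^sub>1\<close> by (auto simp: \<theta>_def)
  let ?y = "\<lambda>r. \<theta>\<^sup>2 * y\<^sub>2 (\<theta> * r)"
  have "riccati_solution k a (\<theta>\<^sup>2 * M\<^sub>2) ?y"
    using fast \<theta>_range by (intro riccati_solution_rescale) auto
  then have "riccati_comparison k a M\<^sub>1 (\<theta>\<^sup>2 * M\<^sub>2) y\<^sub>1 ?y"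
    using slow \<theta>_range by (simp add: riccati_comparison_def riccati_comparison_axioms_def)
  then have "y\<^sub>1 r \<le> ?y r" if "0 < r" "r < 1" for r
    using riccati_comparison.solution_less that less_imp_le by blast
  then have "eventually (\<lambda>r. y\<^sub>1 r \<le> ?y r) (at_left 1)"
    by (auto simp: eventually_at_left_field intro: exI[of _ 0])
  then have "filterlim ?y at_top (at_left 1)"
    by (rule filterlim_at_top_mono[OF slow(3)])
  moreover have "(?y \<longlongrightarrow> ?y 1) (at_left 1)"
  proof -
    have "isCont (\<lambda>r. y\<^sub>2 (\<theta> * r)) 1"
      using riccati_solution.isCont_solution[OF fast \<theta>_range(1,2)]
      by (intro isCont_o2[where g = y\<^sub>2 and f = "\<lambda>r. \<theta> * r"]) auto
    then have "isCont ?y 1" by (rule continuous_mult_left)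
    then show ?thesis unfolding isCont_def by (rule tendsto_within_subset) simp
  qed
  ultimately show False
    using not_tendsto_and_filterlim_at_infinity filterlim_at_top_imp_at_infinity
      trivial_limit_at_left_real by blast
qed

section \<open>From eigenpairs to the Riccati equation\<close>

definition radial_rate :: "real \<Rightarrow> real \<Rightarrow> real \<Rightarrow> real" where
  "radial_rate k n l = l / real_binom (n - 1) (k - 1) powr (1 / k)"

definition radial_slope :: "(real \<Rightarrow> real) \<Rightarrow> real \<Rightarrow> real" where
  "radial_slope u r = deriv u r / (- r * u r)"

lemma real_binom_pos:
  assumes "1 \<le> k" "k \<le> n"
  shows "real_binom (n - 1) (k - 1) > 0"
  using assms by (simp add: real_binom_def Gamma_real_pos)

lemma radial_rate_pos: "1 \<le> k \<Longrightarrow> k \<le> n \<Longrightarrow> l > 0 \<Longrightarrow> radial_rate k n l > 0"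
  using real_binom_pos[of k n] by (simp add: radial_rate_def)

lemma C2_onD:
  assumes "C2_on S u" "open S" "r \<in> S"
  shows "(u has_real_derivative deriv u r) (at r)"
    and "(deriv u has_real_derivative deriv (deriv u) r) (at r)"
proof -
  have "f differentiable at r" if "f differentiable_on S" for f :: "real \<Rightarrow> real"
    using that assms(2,3) at_within_open[of r S] by (auto simp: differentiable_on_def)
  then show "(u has_real_derivative deriv u r) (at r)"
    "(deriv u has_real_derivative deriv (deriv u) r) (at r)"
    using assms(1) by (auto simp: C2_on_def DERIV_deriv_iff_real_differentiable)
qed

lemma alpha_convexD:
  assumes "alpha_convex a u" "0 < r" "r < 1"
  shows "(u has_real_derivative deriv u r) (at r)"
    and "(deriv u has_real_derivative deriv (deriv u) r) (at r)"
    and "deriv u r \<ge> 0" and "deriv (deriv u) r + (a - 1) * (deriv u r / r) \<ge> 0"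
  using assms C2_onD[of "{0<..<1}" u r] by (auto simp: alpha_convex_def)

lemma alpha_convex_flux_mono:
  assumes convex: "alpha_convex a u" and st_range: "0 < s" "s \<le> t" "t < 1"
  shows "s powr (a - 1) * deriv u s \<le> t powr (a - 1) * deriv u t"
proof (rule DERIV_nonneg_imp_nondecreasing[OF st_range(2)])
  fix x assume "s \<le> x" "x \<le> t"
  then have x_range: "0 < x" "x < 1" using st_range by auto
  have "((\<lambda>r. r powr (a - 1) * deriv u r) has_real_derivative
      (a - 1) * x powr (a - 1 - 1) * deriv u x + deriv (deriv u) x * x powr (a - 1)) (at x)"
    using x_range convex by (auto intro!: derivative_eq_intros alpha_convexD)
  moreover have "x powr (a - 1 - 1) = x powr (a - 1) / x"
    using x_range by (simp only: powr_diff powr_one)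
  then have "(a - 1) * x powr (a - 1 - 1) * deriv u x + deriv (deriv u) x * x powr (a - 1) =
      x powr (a - 1) * (deriv (deriv u) x + (a - 1) * (deriv u x / x))"
    by (simp only:) (simp add: algebra_simps)
  moreover have "0 \<le> x powr (a - 1) * (deriv (deriv u) x + (a - 1) * (deriv u x / x))"
    using alpha_convexD(4)[OF convex x_range] by simp
  ultimately show "\<exists>D. ((\<lambda>r. r powr (a - 1) * deriv u r) has_real_derivative D) (at x) \<and> 0 \<le> D"
    by auto
qed

locale radial_solution =
  fixes k n :: real and u :: "real \<Rightarrow> real" and l :: real
  assumes k_ge_1: "1 \<le> k" and k_le_n: "k \<le> n" and l_pos: "l > 0"
    and convex: "alpha_convex (n / k) u"
    and neg: "\<And>r. 0 < r \<Longrightarrow> r < 1 \<Longrightarrow> u r < 0"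
    and deriv_pos: "\<And>r. 0 < r \<Longrightarrow> r < 1 \<Longrightarrow> deriv u r > 0"
    and equation: "\<And>r. 0 < r \<Longrightarrow> r < 1 \<Longrightarrow> radial_hessian k n u r = rpow (- l * u r) k"
    and tendsto_at_right_0: "(u \<longlongrightarrow> -1) (at_right 0)"
begin

lemma radial_slope_pos: "0 < r \<Longrightarrow> r < 1 \<Longrightarrow> radial_slope u r > 0"
  using neg[of r] deriv_pos[of r] by (simp add: radial_slope_def divide_pos_neg mult_pos_neg)

lemma second_deriv:
  assumes r_range: "0 < r" "r < 1"
  shows "deriv (deriv u) r =
    ((radial_rate k n l / radial_slope u r) powr k - (n / k - 1)) * (deriv u r / r)"
proof -
  define c where "c = real_binom (n - 1) (k - 1)"
  define q where "q = deriv u r / r"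
  define Y where "Y = radial_slope u r"
  have c_pos: "c > 0" using real_binom_pos[OF k_ge_1 k_le_n] by (simp add: c_def)
  have q_pos: "q > 0" using deriv_pos[OF r_range] r_range by (simp add: q_def)
  have Y_pos: "Y > 0" using radial_slope_pos[OF r_range] by (simp add: Y_def)
  have u_eq: "- u r = q / Y"
    using r_range neg[OF r_range] deriv_pos[OF r_range] by (simp add: q_def Y_def radial_slope_def)
  have "radial_hessian k n u r = c * q powr (k - 1) * (deriv (deriv u) r + (n / k - 1) * q)"
    using q_pos k_ge_1
    by (simp add: radial_hessian_def rpow_def diff_divide_distrib flip: c_def q_def)
  moreover have "rpow (- l * u r) k = (l * (q / Y)) powr k"
    using k_ge_1 by (simp add: rpow_def flip: u_eq)
  moreover have "\<dots> = c * q powr (k - 1) * ((radial_rate k n l / Y) powr k * q)"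
    using k_ge_1 l_pos q_pos Y_pos c_pos
    by (simp add: radial_rate_def powr_mult powr_divide powr_powr powr_diff flip: c_def)
  ultimately have "deriv (deriv u) r + (n / k - 1) * q = (radial_rate k n l / Y) powr k * q"
    using equation[OF r_range] c_pos q_pos by simp
  then have "deriv (deriv u) r = (radial_rate k n l / Y) powr k * q - (n / k - 1) * q" by linarith
  then show ?thesis by (simp only: q_def Y_def left_diff_distrib)
qed

lemma riccati_solution_radial_slope:
  "riccati_solution k (n / k) (radial_rate k n l) (radial_slope u)"
proof
  show "k > 0" "n / k > 0" "radial_rate k n l > 0"
    using k_ge_1 k_le_n l_pos radial_rate_pos by auto
  fix r :: real assume r_range: "0 < r" "r < 1"
  show "radial_slope u r > 0" by (rule radial_slope_pos[OF r_range])
  let ?u' = "deriv u r" and ?u'' = "deriv (deriv u) r" and ?y = "radial_slope u r"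
  have "((\<lambda>r. - r * u r) has_real_derivative - u r - r * ?u') (at r)"
    by (auto intro!: derivative_eq_intros alpha_convexD[OF convex r_range])
  then have "(radial_slope u has_real_derivative
      (?u'' * (- r * u r) - ?u' * (- u r - r * ?u')) / ((- r * u r) * (- r * u r))) (at r)"
    unfolding radial_slope_def[abs_def] using r_range neg[OF r_range]
    by (intro DERIV_divide alpha_convexD[OF convex r_range]) auto
  moreover have "(?u'' * (- r * u r) - ?u' * (- u r - r * ?u')) / ((- r * u r) * (- r * u r)) =
      ?y * ((radial_rate k n l / ?y) powr k - n / k + r\<^sup>2 * ?y) / r"
  proof -
    have deriv_eq: "?u' = - r * u r * ?y"
      using r_range neg[OF r_range] by (simp add: radial_slope_def)
    have second_deriv_eq: "?u'' = ((radial_rate k n l / ?y) powr k - (n / k - 1)) * (- u r * ?y)"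
      using second_deriv[OF r_range] r_range deriv_eq by simp
    have "((X - (a - 1)) * (- v * Y) * (- r * v) - - r * v * Y * (- v - r * (- r * v * Y))) /
        ((- r * v) * (- r * v)) = Y * (X - a + r\<^sup>2 * Y) / r" if "v \<noteq> 0" for X a v Y
      using r_range that by (simp add: divide_simps power2_eq_square) algebra
    then show ?thesis unfolding second_deriv_eq deriv_eq using neg[OF r_range] by simp
  qed
  ultimately show "(radial_slope u has_real_derivative
      ?y * ((radial_rate k n l / ?y) powr k - n / k + r\<^sup>2 * ?y) / r) (at r)"
    by (rule DERIV_cong)
qed

lemma Bfun_radial_slope: "Bfun (radial_slope u) (at_right 0)"
proof -
  have "Limsup (at_right 0) (\<lambda>r. ereal (deriv u r / r)) < \<infinity>"
    using convex by (simp add: alpha_convex_def)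
  then obtain C where "Limsup (at_right 0) (\<lambda>r. ereal (deriv u r / r)) < ereal C"
    using less_PInf_Ex_of_nat by (metis ereal_dense2 less_ereal.simps(4))
  then have "eventually (\<lambda>r. ereal (deriv u r / r) < ereal C) (at_right 0)"
    by (rule Limsup_lessD)
  moreover have "eventually (\<lambda>r. u r < - 1 / 2) (at_right 0)"
    by (rule order_tendstoD[OF tendsto_at_right_0]) simp
  moreover have "eventually (\<lambda>r. r \<in> {0<..<1}) (at_right (0::real))"
    by (rule eventually_at_right_real) simp
  ultimately have "eventually (\<lambda>r. norm (radial_slope u r) \<le> 2 * C) (at_right 0)"
  proof eventually_elim
    case (elim r)
    have "0 < deriv u r / r" using elim deriv_pos[of r] by simp
    then have "(deriv u r / r) / (- u r) \<le> C / (1 / 2)"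
      using elim by (intro frac_le) auto
    then show ?case using radial_slope_pos[of r] elim by (simp add: radial_slope_def)
  qed
  then show ?thesis by (rule BfunI)
qed

lemma radial_rate_le:
  "radial_rate k n l \<le> (n / k) powr (1 / k) * critical_rate (n / k)"
  by (rule riccati_solution.rate_le_critical_rate[OF riccati_solution_radial_slope])

end

lemma radial_eigenpair_deriv_pos:
  assumes eigenpair: "radial_eigenpair k n u l" and "1 \<le> k" and r_range: "0 < r" "r < 1"
  shows "deriv u r > 0"
proof (rule ccontr)
  assume "\<not> deriv u r > 0"
  have convex: "alpha_convex (n / k) u" and "l > 0"
    using eigenpair by (auto simp: radial_eigenpair_def)
  have flat: "deriv u s = 0" if s_range: "0 < s" "s \<le> r" for s
  proof -
    have "s powr (n / k - 1) * deriv u s \<le> r powr (n / k - 1) * deriv u r"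
      by (rule alpha_convex_flux_mono[OF convex s_range r_range(2)])
    also have "\<dots> \<le> 0" using \<open>\<not> deriv u r > 0\<close> by (simp add: mult_nonneg_nonpos)
    finally show ?thesis
      using alpha_convexD(3)[OF convex, of s] s_range r_range by (simp add: mult_le_0_iff)
  qed
  have zero: "u s = 0" if s_range: "0 < s" "s < r" for s
  proof -
    have "(deriv u has_real_derivative 0) (at s)"
      by (rule has_field_derivative_transform_within_open[of "\<lambda>_. 0" _ _ "{0<..<r}"])
        (use s_range flat in auto)
    then have "deriv (deriv u) s = 0" by (rule DERIV_imp_deriv)
    then have "radial_hessian k n u s = 0"
      using flat[of s] s_range by (simp add: radial_hessian_def)
    then have "rpow (- l * u s) k = 0"
      using eigenpair s_range r_range by (simp add: radial_eigenpair_def)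
    then show ?thesis using \<open>l > 0\<close> \<open>1 \<le> k\<close> by (simp add: rpow_def)
  qed
  have "(u \<longlongrightarrow> -1) (at_right 0)" using eigenpair by (simp add: radial_eigenpair_def)
  moreover have "eventually (\<lambda>s. u s = 0) (at_right 0)"
    using eventually_at_right_real[OF r_range(1)] by eventually_elim (simp add: zero)
  then have "(u \<longlongrightarrow> 0) (at_right 0)" by (rule tendsto_eventually)
  ultimately show False using tendsto_unique[of "at_right 0" u "-1" 0] by simp
qed

lemma radial_eigenpair_neg:
  assumes eigenpair: "radial_eigenpair k n u l" and "1 \<le> k" and r_range: "0 < r" "r < 1"
  shows "u r < 0"
proof -
  have convex: "alpha_convex (n / k) u" using eigenpair by (simp add: radial_eigenpair_def)
  have deriv: "\<exists>D. (u has_real_derivative D) (at x) \<and> 0 < D" if "0 < x" "x < 1" for x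
    using alpha_convexD(1)[OF convex that] radial_eigenpair_deriv_pos[OF assms(1,2) that] by blast
  define m where "m = (r + 1) / 2"
  have m_range: "r < m" "m < 1" using r_range by (auto simp: m_def)
  have "u r < u m"
    by (rule DERIV_pos_imp_increasing[OF m_range(1)]) (use deriv r_range m_range in auto)
  moreover have "0 \<le> - u m"
  proof (rule DERIV_nonpos_imp_ge_at_left_limit[OF _ order_refl _ _ m_range(2)])
    show "((\<lambda>r. - u r) \<longlongrightarrow> 0) (at_left 1)"
      using eigenpair by (auto simp: radial_eigenpair_def intro: tendsto_eq_intros)
    fix x :: real assume "0 < x" "x < 1"
    then show "\<exists>D. ((\<lambda>r. - u r) has_real_derivative D) (at x) \<and> D \<le> 0"
      using deriv[of x] DERIV_minus by (metis less_imp_le neg_le_0_iff_le)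
  qed (use m_range r_range in auto)
  ultimately show ?thesis by simp
qed

lemma radial_eigenpair_imp_radial_solution:
  assumes "radial_eigenpair k n u l" "1 \<le> k" "k \<le> n"
  shows "radial_solution k n u l"
  using assms radial_eigenpair_neg[OF assms(1,2)] radial_eigenpair_deriv_pos[OF assms(1,2)]
  by unfold_locales (auto simp: radial_eigenpair_def)

lemma radial_slope_at_top:
  assumes eigenpair: "radial_eigenpair k n u l" and "1 \<le> k" "k \<le> n"
  shows "filterlim (radial_slope u) at_top (at_left 1)"
proof -
  interpret radial_solution k n u l
    using assms by (rule radial_eigenpair_imp_radial_solution)
  define C where "C = (1 / 2) powr (n / k - 1) * deriv u (1 / 2)"
  have C_pos: "C > 0" using deriv_pos[of "1 / 2"] by (simp add: C_def)
  have near_1: "eventually (\<lambda>r. r \<in> {1/2<..<1}) (at_left (1::real))"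
    by (rule eventually_at_left_real) simp
  have "((\<lambda>r. - u r) \<longlongrightarrow> - 0) (at_left 1)"
    using eigenpair by (intro tendsto_minus) (simp add: radial_eigenpair_def)
  moreover have "eventually (\<lambda>r. - u r > 0) (at_left 1)"
    using near_1 by eventually_elim (simp add: neg)
  ultimately have "filterlim (\<lambda>r. C / (- u r)) at_top (at_left 1)"
    using C_pos by (intro LIM_at_top_divide[where a = C]) auto
  moreover have "eventually (\<lambda>r. C / (- u r) \<le> radial_slope u r) (at_left 1)"
    using near_1
  proof eventually_elim
    case (elim r)
    then have r_range: "0 < r" "r < 1" "1 / 2 \<le> r" by auto
    have "C \<le> r powr (n / k - 1) * deriv u r"
      unfolding C_def using r_range by (intro alpha_convex_flux_mono[OF convex]) auto
    also have "\<dots> \<le> 1 * deriv u r"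
      using k_ge_1 k_le_n r_range deriv_pos[OF r_range(1,2)]
      by (intro mult_right_mono powr_le1) auto
    also have "\<dots> \<le> deriv u r / r"
      using r_range deriv_pos[OF r_range(1,2)] by (simp add: field_simps)
    finally have "C / (- u r) \<le> (deriv u r / r) / (- u r)"
      using neg[OF r_range(1,2)] by (intro divide_right_mono) auto
    then show ?case by (simp add: radial_slope_def)
  qed
  ultimately show ?thesis by (rule filterlim_at_top_mono)
qed

lemma critical_rate_le_radial_rate:
  assumes eigenpair: "radial_eigenpair k n u l" and k_range: "1 \<le> k" "k \<le> n" and "\<eta> > 0"
  shows "critical_rate (n / k - (1 + \<eta>) powr - k) \<le> (1 + \<eta>) * radial_rate k n l"
proof -
  interpret radial_solution k n u l
    using eigenpair k_range by (rule radial_eigenpair_imp_radial_solution)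
  have rate: "radial_rate k n l > 0" using radial_rate_pos k_range l_pos by blast
  have "radial_rate k n l / ((1 + \<eta>) * radial_rate k n l) = inverse (1 + \<eta>)"
    using rate by (simp add: divide_inverse)
  then have forcing: "(radial_rate k n l / ((1 + \<eta>) * radial_rate k n l)) powr k = (1 + \<eta>) powr - k"
    using \<open>\<eta> > 0\<close> by (simp add: powr_minus inverse_powr)
  have "(1 + \<eta>) powr - k < (1 + \<eta>) powr 0"
    using k_range \<open>\<eta> > 0\<close> by (intro powr_less_mono) auto
  then have "n / k - (1 + \<eta>) powr - k > 0"
    using k_range \<open>\<eta> > 0\<close> by (simp add: less_le_trans)
  then show ?thesis
    using rate \<open>\<eta> > 0\<close> forcing
    by (intro riccati_solution.critical_rate_le_threshold[OF riccati_solution_radial_slope _ _ _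
          Bfun_radial_slope radial_slope_at_top[OF eigenpair k_range]]) auto
qed

lemma radial_eigenpair_le:
  assumes eigenpairs: "radial_eigenpair k n u\<^sub>1 l\<^sub>1" "radial_eigenpair k n u\<^sub>2 l\<^sub>2"
    and k_range: "1 \<le> k" "k \<le> n"
  shows "l\<^sub>2 \<le> l\<^sub>1"
proof -
  note solutions = eigenpairs[THEN radial_eigenpair_imp_radial_solution, OF k_range]
  have "radial_rate k n l\<^sub>2 \<le> radial_rate k n l\<^sub>1"
    using solutions[THEN radial_solution.riccati_solution_radial_slope]
      radial_solution.Bfun_radial_slope[OF solutions(1)]
      radial_slope_at_top[OF eigenpairs(1) k_range]
    by (intro riccati_rate_le_blowup_rate)
  then show ?thesis
    using real_binom_pos[OF k_range] by (simp add: radial_rate_def divide_le_cancel)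
qed

theorem radial_eigenpair_unique:
  assumes "radial_eigenpair k n u\<^sub>1 l\<^sub>1" "radial_eigenpair k n u\<^sub>2 l\<^sub>2" "1 \<le> k" "k \<le> n"
  shows "l\<^sub>1 = l\<^sub>2"
  using radial_eigenpair_le assms by (metis antisym)

section \<open>Power means on the unit interval\<close>

definition power_mean :: "real \<Rightarrow> (real \<Rightarrow> real) \<Rightarrow> real" where
  "power_mean k f = integral {0..1} (\<lambda>s. f s powr k) powr (1 / k)"

definition nonneg_continuous :: "(real \<Rightarrow> real) \<Rightarrow> bool" where
  "nonneg_continuous f \<longleftrightarrow> continuous_on {0..1} f \<and> (\<forall>s\<in>{0..1}. 0 \<le> f s)"

lemma power_mean_nonneg: "power_mean k f \<ge> 0"
  by (simp add: power_mean_def)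

lemma powr_convex_combination_le:
  assumes "k \<ge> 1" "0 \<le> p" "p \<le> 1" "0 \<le> (x::real)"
  shows "(p * x + (1 - p)) powr k \<le> p * x powr k + (1 - p)"
proof (cases "x = 0")
  case True
  have "(1 - p) powr k \<le> (1 - p) powr 1"
    using assms by (intro powr_mono') auto
  then show ?thesis using True assms by simp
next
  case False
  have "((1 - p) *\<^sub>R 1 + p *\<^sub>R x) powr k \<le> (1 - p) * 1 powr k + p * x powr k"
    using assms False by (intro convex_onD[OF powr_convex]) auto
  then show ?thesis by (simp add: algebra_simps)
qed

text \<open>The sum \<open>x + \<delta>\<close> is \<open>A + \<delta>\<close> times the convex combination of \<open>x / A\<close> and \<open>1\<close> with weights \<open>p\<close> and
  \<open>1 - p\<close>.\<close>

lemma powr_add_const_le: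
  fixes x :: real
  assumes "k \<ge> 1" and A_pos: "A > 0" and "\<delta> \<ge> 0" "x \<ge> 0"
  defines "p \<equiv> A / (A + \<delta>)"
  shows "(x + \<delta>) powr k \<le> (A + \<delta>) powr k * (p / A powr k * x powr k + (1 - p))"
proof -
  have p_range: "0 \<le> p" "p \<le> 1" using A_pos \<open>\<delta> \<ge> 0\<close> by (auto simp: p_def)
  have "(A + \<delta>) * p = A" "(A + \<delta>) * (1 - p) = \<delta>"
    using A_pos \<open>\<delta> \<ge> 0\<close> by (auto simp: p_def field_simps)
  then have "x + \<delta> = (A + \<delta>) * (p * (x / A) + (1 - p))"
    using A_pos by (simp add: distrib_left flip: mult.assoc)
  then have "(x + \<delta>) powr k = (A + \<delta>) powr k * (p * (x / A) + (1 - p)) powr k"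
    by (simp only: powr_mult)
  also have "\<dots> \<le> (A + \<delta>) powr k * (p * (x / A) powr k + (1 - p))"
    using assms p_range by (intro mult_left_mono powr_convex_combination_le) auto
  finally show ?thesis by (simp add: powr_divide)
qed

context
  fixes k :: real
  assumes k_ge_1: "k \<ge> 1"
begin

lemma powr_integrable:
  assumes "nonneg_continuous f"
  shows "(\<lambda>s. f s powr k) integrable_on {0..1}"
  using assms k_ge_1 unfolding nonneg_continuous_def
  by (intro integrable_continuous_real continuous_on_powr' continuous_on_const) auto

lemma power_mean_powr:
  assumes "nonneg_continuous f"
  shows "power_mean k f powr k = integral {0..1} (\<lambda>s. f s powr k)"
proof -
  have "0 \<le> integral {0..1} (\<lambda>s. f s powr k)"
    by (intro integral_nonneg powr_integrable assms) simp
  then show ?thesis using k_ge_1 by (simp add: power_mean_def powr_powr)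
qed

lemma power_mean_leI:
  assumes "nonneg_continuous f" "B \<ge> 0" "integral {0..1} (\<lambda>s. f s powr k) \<le> B powr k"
  shows "power_mean k f \<le> B"
proof -
  have "power_mean k f \<le> (B powr k) powr (1 / k)"
    unfolding power_mean_def using assms(3) k_ge_1
    by (intro powr_mono2 integral_nonneg powr_integrable assms(1)) auto
  then show ?thesis using k_ge_1 assms(2) by (simp add: powr_powr)
qed

lemma power_mean_mono:
  assumes "nonneg_continuous f" "nonneg_continuous g" "\<And>s. s \<in> {0..1} \<Longrightarrow> f s \<le> g s"
  shows "power_mean k f \<le> power_mean k g"
proof (rule power_mean_leI)
  show "integral {0..1} (\<lambda>s. f s powr k) \<le> power_mean k g powr k"
    unfolding power_mean_powr[OF assms(2)] using assms k_ge_1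
    by (intro integral_le powr_integrable powr_mono2) (auto simp: nonneg_continuous_def)
qed (use assms in \<open>auto simp: power_mean_nonneg\<close>)

lemma power_mean_const: "B \<ge> 0 \<Longrightarrow> power_mean k (\<lambda>_. B) = B"
  using k_ge_1 by (simp add: power_mean_def powr_powr)

lemma power_mean_add_const_le:
  assumes nonneg_f: "nonneg_continuous f" and "\<delta> \<ge> 0"
  shows "power_mean k (\<lambda>s. f s + \<delta>) \<le> power_mean k f + \<delta>"
proof (rule field_le_epsilon)
  fix \<epsilon> :: real assume "\<epsilon> > 0"
  define A where "A = power_mean k f + \<epsilon>"
  have A_pos: "A > 0" using \<open>\<epsilon> > 0\<close> power_mean_nonneg[of k f] by (simp add: A_def)
  define p where "p = A / (A + \<delta>)"
  have p_range: "0 \<le> p" "p \<le> 1" using A_pos \<open>\<delta> \<ge> 0\<close> by (auto simp: p_def)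
  let ?I = "integral {0..1} (\<lambda>s. f s powr k)"
  have bound: "((\<lambda>s. (A + \<delta>) powr k * (p / A powr k * f s powr k + (1 - p))) has_integral
      (A + \<delta>) powr k * (p / A powr k * ?I + (1 - p) * 1)) {0..1}"
    using has_integral_const_real[of "1 - p" 0 1]
    by (intro has_integral_mult_right has_integral_add integrable_integral powr_integrable
        nonneg_f) simp
  have nonneg_sum: "nonneg_continuous (\<lambda>s. f s + \<delta>)"
    using nonneg_f \<open>\<delta> \<ge> 0\<close> by (auto simp: nonneg_continuous_def intro!: continuous_intros)
  have "integral {0..1} (\<lambda>s. (f s + \<delta>) powr k) \<le> (A + \<delta>) powr k * (p / A powr k * ?I + (1 - p) * 1)"
    by (rule has_integral_le[OF integrable_integral[OF powr_integrable[OF nonneg_sum]] bound])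
      (use nonneg_f powr_add_const_le[OF k_ge_1 A_pos \<open>\<delta> \<ge> 0\<close>] in
        \<open>auto simp: nonneg_continuous_def p_def\<close>)
  also have "\<dots> \<le> (A + \<delta>) powr k * (p / A powr k * A powr k + (1 - p) * 1)"
    unfolding power_mean_powr[OF nonneg_f, symmetric]
    using p_range \<open>\<epsilon> > 0\<close> k_ge_1 power_mean_nonneg
    by (intro mult_left_mono add_right_mono powr_mono2) (auto simp: A_def)
  also have "\<dots> = (A + \<delta>) powr k" using A_pos by simp
  finally have "power_mean k (\<lambda>s. f s + \<delta>) \<le> A + \<delta>"
    using A_pos \<open>\<delta> \<ge> 0\<close> by (intro power_mean_leI nonneg_sum) auto
  then show "power_mean k (\<lambda>s. f s + \<delta>) \<le> power_mean k f + \<delta> + \<epsilon>" by (simp add: A_def)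
qed

lemma power_mean_Lipschitz:
  assumes nonneg_f: "nonneg_continuous f" and nonneg_g: "nonneg_continuous g"
    and close: "\<And>s. s \<in> {0..1} \<Longrightarrow> \<bar>f s - g s\<bar> \<le> \<delta>"
  shows "\<bar>power_mean k f - power_mean k g\<bar> \<le> \<delta>"
proof -
  have "\<delta> \<ge> 0" using close[of 0] by simp
  have le_add: "power_mean k f' \<le> power_mean k g' + \<delta>"
    if nonneg_f': "nonneg_continuous f'" and nonneg_g': "nonneg_continuous g'"
      and close': "\<And>s. s \<in> {0..1} \<Longrightarrow> f' s \<le> g' s + \<delta>" for f' g'
  proof -
    have "nonneg_continuous (\<lambda>s. g' s + \<delta>)"
      using nonneg_g' \<open>\<delta> \<ge> 0\<close> by (auto simp: nonneg_continuous_def intro!: continuous_intros)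
    then have "power_mean k f' \<le> power_mean k (\<lambda>s. g' s + \<delta>)"
      using nonneg_f' close' by (intro power_mean_mono)
    also have "\<dots> \<le> power_mean k g' + \<delta>"
      by (rule power_mean_add_const_le[OF nonneg_g' \<open>\<delta> \<ge> 0\<close>])
    finally show ?thesis .
  qed
  have "f s \<le> g s + \<delta>" "g s \<le> f s + \<delta>" if "s \<in> {0..1}" for s
    using close[OF that] by auto
  then show ?thesis
    using le_add[OF nonneg_f nonneg_g] le_add[OF nonneg_g nonneg_f] by (simp add: abs_le_iff)
qed

end

section \<open>A fixed point theorem in a weighted supremum norm\<close>

definition unit_valued :: "('a::metric_space \<Rightarrow> real) \<Rightarrow> bool" where
  "unit_valued w \<longleftrightarrow> continuous_on UNIV w \<and> (\<forall>x. 0 \<le> w x \<and> w x \<le> 1)"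

definition weighted :: "('a::metric_space \<Rightarrow> real) \<Rightarrow> ('a \<Rightarrow> real) \<Rightarrow> 'a \<Rightarrow>\<^sub>C real" where
  "weighted \<theta> w = Bcontfun (\<lambda>x. w x / \<theta> x)"

context
  fixes \<theta> :: "'a::metric_space \<Rightarrow> real"
  assumes \<theta>_cont: "continuous_on UNIV \<theta>" and \<theta>_ge_1: "\<And>x. 1 \<le> \<theta> x"
begin

lemma weight_pos: "\<theta> x > 0"
  using \<theta>_ge_1[of x] by linarith

lemma apply_weighted:
  assumes unit_w: "unit_valued w"
  shows "apply_bcontfun (weighted \<theta> w) x = w x / \<theta> x"
proof -
  have "(\<lambda>x. w x / \<theta> x) \<in> bcontfun"
  proof (rule bcontfun_normI)
    show "continuous_on UNIV (\<lambda>x. w x / \<theta> x)"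
      using unit_w \<theta>_cont weight_pos
      by (intro continuous_on_divide) (auto simp: unit_valued_def less_imp_neq[symmetric])
    show "norm (w x / \<theta> x) \<le> 1" for x
      using unit_w \<theta>_ge_1[of x] weight_pos[of x]
      by (auto simp: unit_valued_def divide_le_eq intro: order_trans)
  qed
  then show ?thesis by (simp add: weighted_def Bcontfun_inverse)
qed

lemma weighted_mem_PiC: "unit_valued w \<Longrightarrow> weighted \<theta> w \<in> PiC UNIV (\<lambda>x. {0..1 / \<theta> x})"
  using weight_pos
  by (auto simp: mem_PiC_iff apply_weighted unit_valued_def divide_right_mono less_imp_le)

lemma unit_valued_unweighted:
  assumes "\<phi> \<in> PiC UNIV (\<lambda>x. {0..1 / \<theta> x})"
  shows "unit_valued (\<lambda>x. \<theta> x * apply_bcontfun \<phi> x)"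
proof -
  have "0 \<le> \<theta> x * apply_bcontfun \<phi> x \<and> \<theta> x * apply_bcontfun \<phi> x \<le> 1" for x
  proof -
    have "0 \<le> apply_bcontfun \<phi> x" "apply_bcontfun \<phi> x \<le> 1 / \<theta> x"
      using assms by (auto simp: mem_PiC_iff Pi_iff)
    then show ?thesis using weight_pos[of x] by (simp add: field_simps)
  qed
  then show ?thesis
    using \<theta>_cont by (auto simp: unit_valued_def intro!: continuous_on_mult)
qed

theorem weighted_contraction_fixpoint_exists:
  fixes T :: "('a \<Rightarrow> real) \<Rightarrow> 'a \<Rightarrow> real"
  assumes c_range: "0 \<le> c" "c < 1" and maps: "\<And>w. unit_valued w \<Longrightarrow> unit_valued (T w)"
    and contracts: "\<And>w\<^sub>1 w\<^sub>2 d x. unit_valued w\<^sub>1 \<Longrightarrow> unit_valued w\<^sub>2 \<Longrightarrow>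
      (\<And>x. \<bar>w\<^sub>1 x - w\<^sub>2 x\<bar> \<le> d * \<theta> x) \<Longrightarrow> \<bar>T w\<^sub>1 x - T w\<^sub>2 x\<bar> \<le> c * d * \<theta> x"
  shows "\<exists>w. unit_valued w \<and> T w = w"
proof -
  let ?S = "PiC UNIV (\<lambda>x. {0..1 / \<theta> x})"
  define unweighted where "unweighted \<phi> x = \<theta> x * apply_bcontfun \<phi> x" for \<phi> :: "'a \<Rightarrow>\<^sub>C real" and x
  have unit: "unit_valued (T (unweighted \<phi>))" "unit_valued (unweighted \<phi>)" if "\<phi> \<in> ?S" for \<phi>
    using unit_valued_unweighted[OF that] maps by (auto simp: unweighted_def[abs_def])
  have "\<exists>!\<phi>. \<phi> \<in> ?S \<and> weighted \<theta> (T (unweighted \<phi>)) = \<phi>"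
  proof (rule Banach_fix[OF _ _ c_range])
    show "complete ?S" unfolding complete_eq_closed by (rule closed_PiC) simp
    have "unit_valued (\<lambda>_::'a. 0)" by (simp add: unit_valued_def)
    then show "?S \<noteq> {}" using weighted_mem_PiC by blast
    show "(\<lambda>\<phi>. weighted \<theta> (T (unweighted \<phi>))) ` ?S \<subseteq> ?S"
      using unit weighted_mem_PiC by blast
    fix \<phi> \<psi> assume in_S: "\<phi> \<in> ?S" "\<psi> \<in> ?S"
    show "dist (weighted \<theta> (T (unweighted \<phi>))) (weighted \<theta> (T (unweighted \<psi>))) \<le> c * dist \<phi> \<psi>"
    proof (rule dist_bound)
      fix x
      have "\<bar>unweighted \<phi> x - unweighted \<psi> x\<bar> \<le> dist \<phi> \<psi> * \<theta> x" for x
        using mult_left_mono[OF dist_bounded[of \<phi> x \<psi>] less_imp_le[OF weight_pos]] weight_pos[of x]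
        by (simp add: unweighted_def dist_real_def abs_mult mult.commute flip: right_diff_distrib)
      then have "\<bar>T (unweighted \<phi>) x - T (unweighted \<psi>) x\<bar> \<le> c * dist \<phi> \<psi> * \<theta> x"
        by (rule contracts[OF unit(2)[OF in_S(1)] unit(2)[OF in_S(2)]])
      then show "dist (weighted \<theta> (T (unweighted \<phi>)) x) (weighted \<theta> (T (unweighted \<psi>)) x)
          \<le> c * dist \<phi> \<psi>"
        using in_S weight_pos[of x]
        by (simp add: apply_weighted unit dist_real_def divide_le_eq flip: diff_divide_distrib)
    qed
  qed
  then obtain \<phi> where fixpoint: "\<phi> \<in> ?S" "weighted \<theta> (T (unweighted \<phi>)) = \<phi>" by blast
  have "unweighted \<phi> x = T (unweighted \<phi>) x" for x
    using apply_weighted[OF unit(1)[OF fixpoint(1)], of x] fixpoint(2) weight_pos[of x]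
    by (simp add: unweighted_def)
  then have "T (unweighted \<phi>) = unweighted \<phi>" by (simp add: fun_eq_iff)
  then show ?thesis using unit(2)[OF fixpoint(1)] by blast
qed

end

section \<open>Radial means\<close>

text \<open>After the substitution \<open>s = (x / t)\<^sup>n\<close> this is the \<open>L\<^sup>k\<close>-mean of the radial function \<open>w\<close> over
  the ball of radius \<open>t\<close> in dimension \<open>n\<close>.\<close>

definition radial_mean :: "real \<Rightarrow> real \<Rightarrow> (real \<Rightarrow> real) \<Rightarrow> real \<Rightarrow> real" where
  "radial_mean k n w t = power_mean k (\<lambda>s. w (t * s powr (1 / n)))"

lemma radial_mean_nonneg: "radial_mean k n w t \<ge> 0"
  by (simp add: radial_mean_def power_mean_nonneg)

lemma continuous_on_integral_from_0:
  fixes h :: "real \<Rightarrow> real"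
  assumes "continuous_on UNIV h"
  shows "continuous_on UNIV (\<lambda>r. integral {0..r} h)"
proof (rule continuous_at_imp_continuous_on, rule ballI)
  fix r :: real
  define b where "b = \<bar>r\<bar> + 1"
  have "continuous_on {0..b} (\<lambda>r. integral {0..r} h)"
    by (intro indefinite_integral_continuous_1 integrable_continuous_real
        continuous_on_subset[OF assms]) simp
  moreover have "continuous_on {- b..b} (max (0 :: real))" by (intro continuous_intros)
  ultimately have "continuous_on {- b..b} (\<lambda>r. integral {0..max 0 r} h)"
    by (rule continuous_on_compose2) (auto simp: b_def)
  moreover have "integral {0..max 0 r} h = integral {0..r} h" for r
    by (simp add: max_def)
  ultimately have "continuous_on {- b..b} (\<lambda>r. integral {0..r} h)" by simp
  moreover have "r \<in> interior {- b..b}" by (auto simp: b_def abs_if)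
  ultimately show "isCont (\<lambda>r. integral {0..r} h) r" by (rule continuous_on_interior)
qed

lemma DERIV_integral_from_0:
  fixes h :: "real \<Rightarrow> real"
  assumes "continuous_on {0..} h" "r > 0"
  shows "((\<lambda>r. integral {0..r} h) has_real_derivative h r) (at r)"
proof -
  have "continuous_on {0..r + 1} h" using assms(1) by (rule continuous_on_subset) auto
  then have "((\<lambda>r. integral {0..r} h) has_real_derivative h r) (at r within {0..r + 1})"
    using assms(2) by (intro integral_has_real_derivative) auto
  moreover have "at r within {0..r + 1} = at r"
    using assms(2) by (intro at_within_interior) auto
  ultimately show ?thesis by simp
qed

context
  fixes k n :: real
  assumes k_ge_1: "k \<ge> 1" and n_pos: "n > 0"
begin

lemma continuous_on_root: "continuous_on {0..} (\<lambda>s::real. s powr (1 / n))"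
  using n_pos by (intro continuous_on_powr' continuous_intros) auto

lemma nonneg_continuous_dilation:
  assumes "unit_valued w"
  shows "nonneg_continuous (\<lambda>s. w (t * s powr (1 / n)))"
proof -
  have "continuous_on {0..1} (\<lambda>s. t * s powr (1 / n))"
    by (intro continuous_on_mult_left continuous_on_subset[OF continuous_on_root]) auto
  then show ?thesis
    using assms continuous_on_compose2[of UNIV w]
    by (auto simp: nonneg_continuous_def unit_valued_def)
qed

lemma dilation_point_bounds:
  assumes "0 \<le> t" "s \<in> {0..1}"
  shows "0 \<le> t * s powr (1 / n)" "t * s powr (1 / n) \<le> t"
  using assms n_pos powr_le1[of "1 / n" s] by (auto simp: mult_left_le)

lemma radial_mean_le_1:
  assumes "unit_valued w"
  shows "radial_mean k n w t \<le> 1"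
proof -
  have "radial_mean k n w t \<le> power_mean k (\<lambda>_. 1)"
    unfolding radial_mean_def using assms
    by (intro power_mean_mono k_ge_1 nonneg_continuous_dilation)
      (auto simp: nonneg_continuous_def unit_valued_def)
  then show ?thesis using power_mean_const[OF k_ge_1, of 1] by simp
qed

lemma radial_mean_ge:
  assumes unit_w: "unit_valued w" and "t \<ge> 0" "b \<ge> 0" and "\<And>s. 0 \<le> s \<Longrightarrow> s \<le> t \<Longrightarrow> b \<le> w s"
  shows "b \<le> radial_mean k n w t"
proof -
  have "power_mean k (\<lambda>_. b) \<le> radial_mean k n w t"
    unfolding radial_mean_def
    by (rule power_mean_mono[OF k_ge_1 _ nonneg_continuous_dilation[OF unit_w]])
      (use assms dilation_point_bounds in \<open>auto simp: nonneg_continuous_def\<close>)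
  then show ?thesis using power_mean_const[OF k_ge_1 \<open>b \<ge> 0\<close>] by simp
qed

lemma radial_mean_Lipschitz:
  assumes "unit_valued w\<^sub>1" "unit_valued w\<^sub>2" "t \<ge> 0"
    and "\<And>s. 0 \<le> s \<Longrightarrow> s \<le> t \<Longrightarrow> \<bar>w\<^sub>1 s - w\<^sub>2 s\<bar> \<le> \<delta>"
  shows "\<bar>radial_mean k n w\<^sub>1 t - radial_mean k n w\<^sub>2 t\<bar> \<le> \<delta>"
  unfolding radial_mean_def
  by (intro power_mean_Lipschitz k_ge_1 nonneg_continuous_dilation assms dilation_point_bounds)

lemma radial_mean_powr:
  "unit_valued w \<Longrightarrow> radial_mean k n w t powr k = integral {0..1} (\<lambda>s. w (t * s powr (1 / n)) powr k)"
  unfolding radial_mean_def by (intro power_mean_powr k_ge_1 nonneg_continuous_dilation)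

lemma continuous_on_radial_mean:
  assumes unit_w: "unit_valued w"
  shows "continuous_on UNIV (radial_mean k n w)"
proof -
  have "continuous_on (UNIV \<times> cbox 0 1) (\<lambda>x. w (fst x * snd x powr (1 / n)) powr k)"
  proof (intro continuous_on_powr' continuous_on_const)
    have "continuous_on (UNIV \<times> cbox 0 1) (\<lambda>x. snd x powr (1 / n) :: real)"
      by (rule continuous_on_compose2[OF continuous_on_root]) (auto intro: continuous_intros)
    then have "continuous_on (UNIV \<times> cbox 0 1) (\<lambda>x. fst x * snd x powr (1 / n))"
      by (rule continuous_on_mult[OF continuous_on_fst[OF continuous_on_id]])
    from continuous_on_compose2[OF _ this, of UNIV w]
    show "continuous_on (UNIV \<times> cbox 0 1) (\<lambda>x. w (fst x * snd x powr (1 / n)))"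
      using unit_w by (simp add: unit_valued_def)
  qed (use unit_w k_ge_1 in \<open>auto simp: unit_valued_def\<close>)
  then have "continuous_on UNIV (\<lambda>t. integral (cbox 0 1) (\<lambda>s. w (t * s powr (1 / n)) powr k))"
    by (intro integral_continuous_on_param) (simp add: case_prod_unfold)
  then have "continuous_on UNIV (\<lambda>t. radial_mean k n w t powr k)"
    by (simp add: radial_mean_powr[OF unit_w] cbox_interval)
  then have "continuous_on UNIV (\<lambda>t. (radial_mean k n w t powr k) powr (1 / k))"
    by (rule continuous_on_powr'[OF _ continuous_on_const]) (use k_ge_1 in auto)
  then show ?thesis using k_ge_1 by (simp add: powr_powr radial_mean_nonneg)
qed

lemma continuous_on_radial_powr:
  assumes unit_w: "unit_valued w"
  shows "continuous_on {0..} (\<lambda>x. w (x powr (1 / n)) powr k)"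
proof (rule continuous_on_powr'[OF _ continuous_on_const])
  show "continuous_on {0..} (\<lambda>x. w (x powr (1 / n)))"
    using unit_w by (intro continuous_on_compose2[OF _ continuous_on_root, of UNIV w])
      (auto simp: unit_valued_def)
qed (use unit_w k_ge_1 in \<open>auto simp: unit_valued_def\<close>)

lemma radial_mean_powr_eq_integral:
  assumes unit_w: "unit_valued w" and t_pos: "t > 0"
  shows "radial_mean k n w t powr k =
    integral {0..t powr n} (\<lambda>x. w (x powr (1 / n)) powr k) / t powr n"
proof -
  let ?h = "\<lambda>x. w (x powr (1 / n)) powr k"
  have root: "(t powr n * s) powr (1 / n) = t * s powr (1 / n)" for s
    using n_pos t_pos by (simp add: powr_mult powr_powr)
  have "continuous_on {0..t powr n} ?h"
    by (rule continuous_on_subset[OF continuous_on_radial_powr[OF unit_w]]) simp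
  then have "(?h has_integral integral {0..t powr n} ?h) (cbox 0 (t powr n))"
    by (simp add: integrable_continuous_real integrable_integral)
  from has_integral_affinity'[OF this, of "t powr n" 0]
  have "((\<lambda>s. ?h (t powr n * s)) has_integral integral {0..t powr n} ?h / t powr n) {0..1}"
    using t_pos by (simp add: divide_inverse mult.commute)
  then show ?thesis by (simp add: radial_mean_powr[OF unit_w] root integral_unique)
qed

lemma DERIV_radial_mean_powr:
  assumes unit_w: "unit_valued w" and t_pos: "t > 0"
  shows "((\<lambda>t. radial_mean k n w t powr k) has_real_derivative
    n * (w t powr k - radial_mean k n w t powr k) / t) (at t)"
proof -
  define h where "h x = w (x powr (1 / n)) powr k" for x
  let ?I = "\<lambda>t. integral {0..t powr n} h"
  have "continuous_on {0..} h"
    unfolding h_def[abs_def] by (rule continuous_on_radial_powr[OF unit_w])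
  then have "(?I has_real_derivative h (t powr n) * (n * t powr (n - 1))) (at t)"
    using t_pos by (intro DERIV_chain2[OF DERIV_integral_from_0] has_real_derivative_powr) auto
  moreover have "h (t powr n) = w t powr k" using t_pos n_pos by (simp add: h_def powr_powr)
  ultimately have "((\<lambda>t. ?I t / t powr n) has_real_derivative
      (w t powr k * (n * t powr (n - 1)) * t powr n - ?I t * (n * t powr (n - 1))) /
        (t powr n * t powr n)) (at t)"
    using t_pos by (intro DERIV_divide has_real_derivative_powr) auto
  moreover have "(w t powr k * (n * t powr (n - 1)) * t powr n - ?I t * (n * t powr (n - 1))) /
      (t powr n * t powr n) = n * (w t powr k - ?I t / t powr n) / t"
  proof -
    have power: "t powr (n - 1) = t powr n / t" using t_pos by (simp add: powr_diff)
    show ?thesis unfolding power using t_pos by (simp add: divide_simps) algebra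
  qed
  ultimately have "((\<lambda>t. ?I t / t powr n) has_real_derivative
      n * (w t powr k - radial_mean k n w t powr k) / t) (at t)"
    by (simp add: radial_mean_powr_eq_integral[OF unit_w t_pos] h_def[abs_def])
  then show ?thesis
    by (rule has_field_derivative_transform_within_open[of _ _ _ "{0<..}"])
      (use t_pos in \<open>auto simp: radial_mean_powr_eq_integral[OF unit_w] h_def[abs_def]\<close>)
qed

lemma DERIV_radial_mean:
  assumes unit_w: "unit_valued w" and t_pos: "t > 0" and pos: "radial_mean k n w t > 0"
  shows "(radial_mean k n w has_real_derivative
    n / k * (w t powr k * radial_mean k n w t powr (1 - k) - radial_mean k n w t) / t) (at t)"
proof -
  define N where "N = radial_mean k n w t"
  have N_pos: "N > 0" using pos by (simp add: N_def)
  have root: "(N powr k) powr (1 / k - 1) = N powr (1 - k)"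
    using k_ge_1 by (simp add: powr_powr right_diff_distrib)
  have mean: "(\<lambda>t. (radial_mean k n w t powr k) powr (1 / k)) = radial_mean k n w"
    using k_ge_1 by (simp add: fun_eq_iff powr_powr radial_mean_nonneg)
  have "((\<lambda>t. (radial_mean k n w t powr k) powr (1 / k)) has_real_derivative
      1 / k * (N powr k) powr (1 / k - 1) * (n * (w t powr k - N powr k) / t)) (at t)"
    using DERIV_fun_powr[OF DERIV_radial_mean_powr[OF unit_w t_pos], of "1 / k"] N_pos
    by (simp add: N_def)
  then have "(radial_mean k n w has_real_derivative
      1 / k * N powr (1 - k) * (n * (w t powr k - N powr k) / t)) (at t)"
    unfolding root mean .
  moreover have "1 / k * N powr (1 - k) * (n * (w t powr k - N powr k) / t) =
      n / k * (w t powr k * N powr (1 - k) - N) / t"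
  proof -
    have "N powr (1 - k) * N powr k = N" using N_pos by (simp flip: powr_add)
    then show ?thesis using k_ge_1 t_pos by (simp add: field_simps)
  qed
  ultimately show ?thesis unfolding N_def by (rule DERIV_cong)
qed

end

section \<open>Existence of eigenpairs\<close>

text \<open>If \<open>w\<close> is the positive part of \<open>v = volterra_map k n w\<close>, then \<open>u = - v\<close> solves the radial equation
  with \<open>\<lambda>\<^sup>k = (n / k) binom (n - 1) (k - 1)\<close> as long as \<open>v\<close> stays positive.\<close>

definition volterra_map :: "real \<Rightarrow> real \<Rightarrow> (real \<Rightarrow> real) \<Rightarrow> real \<Rightarrow> real" where
  "volterra_map k n w r = 1 - integral {0..r} (\<lambda>t. t * radial_mean k n w t)"

locale radial_profile =
  fixes k n :: real and v :: "real \<Rightarrow> real"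
  assumes k_ge_1: "1 \<le> k" and k_le_n: "k \<le> n"
    and continuous: "continuous_on UNIV v" and le_1: "\<And>t. v t \<le> 1" and at_0: "v 0 = 1"
    and DERIV: "\<And>t. t > 0 \<Longrightarrow>
      (v has_real_derivative - (t * radial_mean k n (\<lambda>s. max 0 (v s)) t)) (at t)"

context
  fixes k n :: real
  assumes k_ge_1: "k \<ge> 1" and n_pos: "n > 0"
begin

lemma continuous_on_radial_flux:
  "unit_valued w \<Longrightarrow> continuous_on S (\<lambda>t. t * radial_mean k n w t)"
  using continuous_on_radial_mean[OF k_ge_1 n_pos]
  by (intro continuous_on_mult continuous_on_id) (auto intro: continuous_on_subset)

lemma continuous_on_volterra_map: "unit_valued w \<Longrightarrow> continuous_on UNIV (volterra_map k n w)"
  unfolding volterra_map_def[abs_def]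
  by (intro continuous_on_diff continuous_on_const continuous_on_integral_from_0
      continuous_on_radial_flux)

lemma volterra_map_le_1:
  assumes "unit_valued w"
  shows "volterra_map k n w r \<le> 1"
proof -
  have "0 \<le> integral {0..r} (\<lambda>t. t * radial_mean k n w t)"
    by (intro integral_nonneg integrable_continuous_real continuous_on_radial_flux assms)
      (simp add: radial_mean_nonneg)
  then show ?thesis by (simp add: volterra_map_def)
qed

lemma radial_flux_diff_le:
  assumes unit_w: "unit_valued w\<^sub>1" "unit_valued w\<^sub>2" and "t \<ge> 0" "d \<ge> 0"
    and close: "\<And>s. \<bar>w\<^sub>1 s - w\<^sub>2 s\<bar> \<le> d * exp (s\<^sup>2)"
  shows "\<bar>t * radial_mean k n w\<^sub>1 t - t * radial_mean k n w\<^sub>2 t\<bar> \<le> t * (d * exp (t\<^sup>2))"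
proof -
  have "\<bar>w\<^sub>1 s - w\<^sub>2 s\<bar> \<le> d * exp (t\<^sup>2)" if s_range: "0 \<le> s" "s \<le> t" for s
  proof -
    have "exp (s\<^sup>2) \<le> exp (t\<^sup>2)" using s_range by (simp add: power_mono)
    then show ?thesis using close[of s] mult_left_mono \<open>d \<ge> 0\<close> order_trans by blast
  qed
  then have "\<bar>radial_mean k n w\<^sub>1 t - radial_mean k n w\<^sub>2 t\<bar> \<le> d * exp (t\<^sup>2)"
    using \<open>t \<ge> 0\<close> by (intro radial_mean_Lipschitz k_ge_1 n_pos unit_w)
  then show ?thesis
    using \<open>t \<ge> 0\<close> by (simp add: abs_mult mult_left_mono flip: right_diff_distrib)
qed

lemma volterra_map_contracts:
  assumes unit_w: "unit_valued w\<^sub>1" "unit_valued w\<^sub>2"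
    and close: "\<And>s. \<bar>w\<^sub>1 s - w\<^sub>2 s\<bar> \<le> d * exp (s\<^sup>2)"
  shows "\<bar>volterra_map k n w\<^sub>1 r - volterra_map k n w\<^sub>2 r\<bar> \<le> 1 / 2 * d * exp (r\<^sup>2)"
proof (cases "r \<ge> 0")
  case True
  have "d \<ge> 0" using close[of 0] by simp
  let ?flux = "\<lambda>w t. t * radial_mean k n w t"
  have bound: "((\<lambda>t. t * (d * exp (t\<^sup>2))) has_integral
      d / 2 * exp (r\<^sup>2) - d / 2 * exp (0\<^sup>2)) {0..r}"
    using True
    by (intro fundamental_theorem_of_calculus)
      (auto intro!: derivative_eq_intros simp flip: has_real_derivative_iff_has_vector_derivative)
  have "volterra_map k n w\<^sub>1 r - volterra_map k n w\<^sub>2 r =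
      - integral {0..r} (\<lambda>t. ?flux w\<^sub>1 t - ?flux w\<^sub>2 t)"
    unfolding volterra_map_def
    by (subst integral_diff)
      (auto intro!: integrable_continuous_real continuous_on_radial_flux unit_w)
  also have "\<bar>\<dots>\<bar> \<le> integral {0..r} (\<lambda>t. t * (d * exp (t\<^sup>2)))"
    unfolding real_norm_def[symmetric] norm_minus_cancel
  proof (rule integral_norm_bound_integral)
    show "(\<lambda>t. ?flux w\<^sub>1 t - ?flux w\<^sub>2 t) integrable_on {0..r}"
      by (intro integrable_diff integrable_continuous_real continuous_on_radial_flux unit_w)
    show "(\<lambda>t. t * (d * exp (t\<^sup>2))) integrable_on {0..r}"
      using bound by (rule has_integral_integrable)
  qed (use radial_flux_diff_le[OF unit_w _ \<open>d \<ge> 0\<close> close] in auto)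
  also have "\<dots> \<le> 1 / 2 * d * exp (r\<^sup>2)"
    using integral_unique[OF bound] \<open>d \<ge> 0\<close> by simp
  finally show ?thesis .
next
  case False
  then show ?thesis using close[of 0] by (simp add: volterra_map_def)
qed

lemma DERIV_volterra_map:
  assumes "unit_valued w" "t > 0"
  shows "(volterra_map k n w has_real_derivative - (t * radial_mean k n w t)) (at t)"
  using DERIV_diff[OF DERIV_const[of 1]
      DERIV_integral_from_0[OF continuous_on_radial_flux[OF assms(1)] assms(2)]]
  by (simp add: volterra_map_def[abs_def])

end

theorem radial_profile_exists:
  assumes k_range: "1 \<le> k" "k \<le> n"
  shows "\<exists>v. radial_profile k n v"
proof -
  have n_pos: "n > 0" using k_range by simp
  have "\<exists>w. unit_valued w \<and> (\<lambda>r. max 0 (volterra_map k n w r)) = w"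
  proof (rule weighted_contraction_fixpoint_exists[of "\<lambda>r. exp (r\<^sup>2)" "1 / 2"])
    show "unit_valued (\<lambda>r. max 0 (volterra_map k n w r))" if "unit_valued w" for w
      using continuous_on_volterra_map[OF k_range(1) n_pos that]
        volterra_map_le_1[OF k_range(1) n_pos that]
      by (auto simp: unit_valued_def intro!: continuous_on_max continuous_on_const)
    fix w\<^sub>1 w\<^sub>2 :: "real \<Rightarrow> real" and d r :: real
    assume "unit_valued w\<^sub>1" "unit_valued w\<^sub>2" "\<And>x. \<bar>w\<^sub>1 x - w\<^sub>2 x\<bar> \<le> d * exp (x\<^sup>2)"
    then have "\<bar>volterra_map k n w\<^sub>1 r - volterra_map k n w\<^sub>2 r\<bar> \<le> 1 / 2 * d * exp (r\<^sup>2)"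
      by (rule volterra_map_contracts[OF k_range(1) n_pos])
    then show "\<bar>max 0 (volterra_map k n w\<^sub>1 r) - max 0 (volterra_map k n w\<^sub>2 r)\<bar>
        \<le> 1 / 2 * d * exp (r\<^sup>2)"
      by linarith
  qed (auto intro!: continuous_intros)
  then obtain w where fixpoint: "unit_valued w" "(\<lambda>r. max 0 (volterra_map k n w r)) = w" by blast
  have "radial_profile k n (volterra_map k n w)"
    using k_range DERIV_volterra_map[OF k_range(1) n_pos fixpoint(1)]
      continuous_on_volterra_map[OF k_range(1) n_pos fixpoint(1)]
      volterra_map_le_1[OF k_range(1) n_pos fixpoint(1)]
    by unfold_locales (simp_all add: fixpoint(2), simp add: volterra_map_def)
  then show ?thesis by blast
qed

context radial_profile
begin

definition mean :: "real \<Rightarrow> real" where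
  "mean = radial_mean k n (\<lambda>s. max 0 (v s))"

definition flux_deriv :: "real \<Rightarrow> real" where
  "flux_deriv t = (1 - n / k) * mean t + n / k * (v t powr k * mean t powr (1 - k))"

lemma n_pos: "n > 0"
  using k_ge_1 k_le_n by simp

lemma unit_valued_positive_part: "unit_valued (\<lambda>s. max 0 (v s))"
  using continuous le_1 by (simp add: unit_valued_def continuous_on_max)

lemma antimono:
  assumes "0 \<le> s" "s \<le> t"
  shows "v t \<le> v s"
proof (rule DERIV_nonpos_imp_decreasing_open[OF assms(2)])
  fix x assume x_range: "s < x" "x < t"
  have "0 \<le> x * radial_mean k n (\<lambda>s. max 0 (v s)) x"
    using x_range assms(1) by (simp add: radial_mean_nonneg)
  then show "\<exists>D. (v has_real_derivative D) (at x) \<and> D \<le> 0"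
    using DERIV[of x] x_range assms(1) by (intro exI conjI) auto
qed (rule continuous_on_subset[OF continuous subset_UNIV])

lemma mean_le_1: "mean t \<le> 1"
  unfolding mean_def by (rule radial_mean_le_1[OF k_ge_1 n_pos unit_valued_positive_part])

lemma mean_pos:
  assumes "t \<ge> 0" "v t > 0"
  shows "mean t > 0"
proof -
  have "v t \<le> mean t"
    unfolding mean_def
    by (rule radial_mean_ge[OF k_ge_1 n_pos unit_valued_positive_part])
      (use assms antimono in \<open>auto simp: less_imp_le intro: max.coboundedI2\<close>)
  then show ?thesis using assms by simp
qed

lemma DERIV_mean:
  assumes "t > 0" "v t > 0"
  shows "(mean has_real_derivative n / k * (v t powr k * mean t powr (1 - k) - mean t) / t) (at t)"
  using DERIV_radial_mean[OF k_ge_1 n_pos unit_valued_positive_part, of t] mean_pos[of t] assms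
  by (simp add: mean_def max_absorb2)

lemma DERIV_flux:
  assumes "t > 0" "v t > 0"
  shows "((\<lambda>t. t * mean t) has_real_derivative flux_deriv t) (at t)"
proof (rule DERIV_cong[OF DERIV_mult[OF DERIV_ident DERIV_mean[OF assms]]])
  have "n / k * (X - N) / t * t = n / k * (X - N)" for X N
    using assms by simp
  then show "1 * mean t + n / k * (v t powr k * mean t powr (1 - k) - mean t) / t * t =
      flux_deriv t"
    by (simp only: flux_deriv_def) (simp add: algebra_simps)
qed

lemma isCont_flux_deriv:
  assumes "t > 0" "v t > 0"
  shows "isCont flux_deriv t"
proof -
  have "isCont v t" "isCont mean t"
    using DERIV_isCont[OF DERIV] DERIV_isCont[OF DERIV_mean] assms by auto
  then show ?thesis
    unfolding flux_deriv_def[abs_def] isCont_def using assms mean_pos[of t]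
    by (intro tendsto_intros) auto
qed

end

locale positive_radial_profile = radial_profile +
  fixes R :: real
  assumes R_pos: "R > 0" and pos: "\<And>t. 0 \<le> t \<Longrightarrow> t < R \<Longrightarrow> v t > 0"
begin

definition dilation :: "real \<Rightarrow> real" where
  "dilation r = - v (R * r)"

definition eigenvalue :: real where
  "eigenvalue = R\<^sup>2 * (n / k * real_binom (n - 1) (k - 1)) powr (1 / k)"

lemma dilated_point:
  assumes "0 < r" "r < 1"
  shows "0 < R * r" "v (R * r) > 0" "mean (R * r) > 0"
  using assms R_pos pos[of "R * r"] mean_pos[of "R * r"] by auto

lemma DERIV_dilation:
  assumes "r > 0"
  shows "(dilation has_real_derivative R * (R * r * mean (R * r))) (at r)"
proof -
  have "((\<lambda>r. v (R * r)) has_real_derivative - (R * r * mean (R * r)) * R) (at r)"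
    using DERIV[of "R * r"] assms R_pos
    by (intro DERIV_chain2[where f = v]) (auto intro!: derivative_eq_intros simp: mean_def)
  from DERIV_minus[OF this] show ?thesis by (simp add: dilation_def[abs_def] mult.commute)
qed

lemma deriv_dilation: "r > 0 \<Longrightarrow> deriv dilation r = R * (R * r * mean (R * r))"
  using DERIV_dilation by (rule DERIV_imp_deriv)

lemma DERIV_deriv_dilation:
  assumes "0 < r" "r < 1"
  shows "(deriv dilation has_real_derivative R\<^sup>2 * flux_deriv (R * r)) (at r)"
proof (rule has_field_derivative_transform_within_open)
  have "((\<lambda>r. R * r * mean (R * r)) has_real_derivative flux_deriv (R * r) * R) (at r)"
    using dilated_point[OF assms]
    by (intro DERIV_chain2[OF DERIV_flux]) (auto intro!: derivative_eq_intros)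
  from DERIV_cmult[OF this, of R]
  show "((\<lambda>r. R * (R * r * mean (R * r))) has_real_derivative R\<^sup>2 * flux_deriv (R * r)) (at r)"
    by (simp add: power2_eq_square mult_ac)
qed (use assms deriv_dilation in \<open>auto intro: open_greaterThan\<close>)

lemma second_deriv_dilation:
  "0 < r \<Longrightarrow> r < 1 \<Longrightarrow> deriv (deriv dilation) r = R\<^sup>2 * flux_deriv (R * r)"
  using DERIV_deriv_dilation by (rule DERIV_imp_deriv)

lemma second_deriv_dilation_add:
  assumes "0 < r" "r < 1"
  shows "deriv (deriv dilation) r + (n / k - 1) * (deriv dilation r / r) =
    R\<^sup>2 * (n / k * (v (R * r) powr k * mean (R * r) powr (1 - k)))"
proof -
  have "deriv dilation r / r = R\<^sup>2 * mean (R * r)"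
    using assms by (simp add: deriv_dilation power2_eq_square)
  then show ?thesis
    using assms by (simp add: second_deriv_dilation flux_deriv_def algebra_simps)
qed

lemma C2_on_dilation: "C2_on {0<..<1} dilation"
proof -
  have "continuous_on {0<..<1} (\<lambda>r. R\<^sup>2 * flux_deriv (R * r))"
  proof (rule continuous_at_imp_continuous_on, rule ballI)
    fix r :: real assume "r \<in> {0<..<1}"
    then have "isCont flux_deriv (R * r)"
      using dilated_point[of r] by (intro isCont_flux_deriv) auto
    then have "isCont (\<lambda>r. flux_deriv (R * r)) r"
      by (intro isCont_o2[where f = "\<lambda>r. R * r" and g = flux_deriv]) auto
    then show "isCont (\<lambda>r. R\<^sup>2 * flux_deriv (R * r)) r" by (rule continuous_mult_left)
  qed
  then have "continuous_on {0<..<1} (deriv (deriv dilation))"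
    using second_deriv_dilation
    by (subst continuous_on_cong[OF refl, of _ _ "\<lambda>r. R\<^sup>2 * flux_deriv (R * r)"]) auto
  moreover have "dilation differentiable_on {0<..<1}" "deriv dilation differentiable_on {0<..<1}"
    unfolding differentiable_on_def real_differentiable_def
    using DERIV_dilation DERIV_deriv_dilation
    by (meson has_field_derivative_at_within greaterThanLessThan_iff)+
  ultimately show ?thesis by (simp add: C2_on_def)
qed

lemma alpha_convex_dilation: "alpha_convex (n / k) dilation"
proof -
  have "eventually (\<lambda>r. ereal (deriv dilation r / r) \<le> ereal (R\<^sup>2)) (at_right 0)"
    using eventually_at_right_less
  proof eventually_elim
    case (elim r)
    have "R\<^sup>2 * mean (R * r) \<le> R\<^sup>2 * 1" by (intro mult_left_mono mean_le_1) simp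
    then show ?case using elim by (simp add: deriv_dilation power2_eq_square mult_ac)
  qed
  then have "Limsup (at_right 0) (\<lambda>r. ereal (deriv dilation r / r)) \<le> ereal (R\<^sup>2)"
    by (rule Limsup_bounded)
  then have "Limsup (at_right 0) (\<lambda>r. ereal (deriv dilation r / r)) < \<infinity>"
    by (rule le_less_trans) simp
  moreover have "deriv dilation r \<ge> 0" if "0 < r" "r < 1" for r
    using dilated_point[OF that] R_pos that by (simp add: deriv_dilation)
  moreover have "0 \<le> deriv (deriv dilation) r + (n / k - 1) * (deriv dilation r / r)"
    if "0 < r" "r < 1" for r
    unfolding second_deriv_dilation_add[OF that] using k_ge_1 n_pos by simp
  ultimately show ?thesis using C2_on_dilation by (simp add: alpha_convex_def)
qed

lemma radial_hessian_dilation: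
  assumes r_range: "0 < r" "r < 1"
  shows "radial_hessian k n dilation r = rpow (- eigenvalue * dilation r) k"
proof -
  define c where "c = real_binom (n - 1) (k - 1)"
  define N where "N = mean (R * r)"
  define V where "V = v (R * r)"
  have N_pos: "N > 0" using dilated_point[OF r_range] by (simp add: N_def)
  have c_pos: "c > 0" using real_binom_pos[OF k_ge_1 k_le_n] by (simp add: c_def)
  have slope: "deriv dilation r / r = R\<^sup>2 * N"
    using r_range by (simp add: deriv_dilation N_def power2_eq_square)
  have "radial_hessian k n dilation r =
      c * (R\<^sup>2 * N) powr (k - 1) * (R\<^sup>2 * (n / k * (V powr k * N powr (1 - k))))"
    using second_deriv_dilation_add[OF r_range] k_ge_1 R_pos N_pos
    by (auto simp: radial_hessian_def rpow_def slope diff_divide_distrib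
        simp flip: c_def N_def V_def)
  also have "\<dots> = (n / k * c) * ((R\<^sup>2) powr (k - 1) * R\<^sup>2) * (N powr (k - 1) * N powr (1 - k)) *
      V powr k"
    by (simp add: powr_mult)
  also have "(R\<^sup>2) powr (k - 1) * R\<^sup>2 = (R\<^sup>2) powr k"
    using R_pos by (simp add: powr_diff)
  also have "N powr (k - 1) * N powr (1 - k) = 1"
    using N_pos by (simp flip: powr_add)
  also have "(n / k * c) * (R\<^sup>2) powr k * 1 * V powr k =
      (R\<^sup>2 * (n / k * c) powr (1 / k) * V) powr k"
    using k_ge_1 n_pos c_pos by (simp add: powr_mult powr_powr)
  also have "\<dots> = rpow (- eigenvalue * dilation r) k"
    using k_ge_1 by (simp add: rpow_def eigenvalue_def dilation_def V_def c_def)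
  finally show ?thesis .
qed

lemma radial_solution_dilation: "radial_solution k n dilation eigenvalue"
proof
  show "1 \<le> k" "k \<le> n" by (fact k_ge_1 k_le_n)+
  show "eigenvalue > 0"
    using R_pos k_ge_1 n_pos real_binom_pos[OF k_ge_1 k_le_n] by (simp add: eigenvalue_def)
  show "alpha_convex (n / k) dilation" by (rule alpha_convex_dilation)
  have "((\<lambda>r. v (R * r)) \<longlongrightarrow> v 0) (at_right 0)"
    by (rule continuous_on_tendsto_compose[OF continuous]) (auto intro!: tendsto_eq_intros)
  then show "(dilation \<longlongrightarrow> -1) (at_right 0)"
    unfolding dilation_def[abs_def] at_0 by (rule tendsto_minus)
  fix r :: real assume r_range: "0 < r" "r < 1"
  show "dilation r < 0" using dilated_point[OF r_range] by (simp add: dilation_def)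
  show "deriv dilation r > 0"
    using dilated_point[OF r_range] R_pos r_range by (simp add: deriv_dilation)
  show "radial_hessian k n dilation r = rpow (- eigenvalue * dilation r) k"
    by (rule radial_hessian_dilation[OF r_range])
qed

lemma R_squared_le: "R\<^sup>2 \<le> critical_rate (n / k)"
proof -
  have "radial_rate k n eigenvalue = (n / k) powr (1 / k) * R\<^sup>2"
    using real_binom_pos[OF k_ge_1 k_le_n]
    by (simp add: radial_rate_def eigenvalue_def powr_mult powr_divide)
  then show ?thesis
    using radial_solution.radial_rate_le[OF radial_solution_dilation] k_ge_1 n_pos by simp
qed

end

theorem radial_eigenpair_exists:
  assumes k_range: "1 \<le> k" "k \<le> n"
  shows "\<exists>u l. radial_eigenpair k n u l"
proof -
  obtain v where "radial_profile k n v" using radial_profile_exists[OF k_range] by blast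
  then interpret radial_profile k n v .
  define b where "b = sqrt (critical_rate (n / k)) + 1"
  have "0 < critical_rate (n / k)" using k_range by (intro critical_rate_pos) simp
  then have b_bounds: "b > 0" "critical_rate (n / k) < b\<^sup>2"
    by (auto simp: b_def power2_sum add_pos_pos)
  have "\<not> (\<forall>t. 0 \<le> t \<longrightarrow> t < b \<longrightarrow> v t > 0)"
  proof
    assume "\<forall>t. 0 \<le> t \<longrightarrow> t < b \<longrightarrow> v t > 0"
    then interpret positive_radial_profile k n v b using b_bounds(1) by unfold_locales auto
    show False using R_squared_le b_bounds(2) by simp
  qed
  then obtain z where "0 \<le> z" "v z \<le> 0" by (meson not_le)
  then obtain R where first_root: "0 < R" "v R = 0" "\<And>t. 0 \<le> t \<Longrightarrow> t < R \<Longrightarrow> v t > 0"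
    using first_zero[of 0 z v] continuous_on_subset[OF continuous] at_0
    by (metis subset_UNIV zero_less_one)
  interpret positive_radial_profile k n v R using first_root by unfold_locales auto
  interpret radial_solution k n dilation eigenvalue by (rule radial_solution_dilation)
  have "((\<lambda>r. v (R * r)) \<longlongrightarrow> v (R * 1)) (at_left 1)"
    by (rule continuous_on_tendsto_compose[OF continuous]) (auto intro!: tendsto_eq_intros)
  then have "(dilation \<longlongrightarrow> 0) (at_left 1)"
    using tendsto_minus first_root(2) by (fastforce simp: dilation_def[abs_def])
  then have "radial_eigenpair k n dilation eigenvalue"
    using convex l_pos equation tendsto_at_right_0 by (simp add: radial_eigenpair_def)
  then show ?thesis by blast
qed

section \<open>Asymptotics of the binomial coefficient\<close>

lemma ln_Gamma_real_plus1:
  fixes x :: real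
  assumes "x > 0"
  shows "ln_Gamma (x + 1) = ln_Gamma x + ln x"
proof -
  have "ln (Gamma (x + 1)) = ln (x * Gamma x)" using assms by (subst Gamma_plus1) auto
  also have "\<dots> = ln x + ln (Gamma x)" using assms Gamma_real_pos[OF assms] by (intro ln_mult_pos)
  finally show ?thesis using assms by (simp add: ln_Gamma_real_pos)
qed

lemma Digamma_real_bounds:
  fixes x :: real
  assumes "x > 0"
  shows "Digamma x \<le> ln x" and "ln x - 1 / x \<le> Digamma x"
proof -
  have "\<exists>z. x < z \<and> z < x + 1 \<and> ln_Gamma (x + 1) - ln_Gamma x = (x + 1 - x) * Digamma z"
    using assms by (intro MVT2) (auto intro!: derivative_eq_intros)
  then obtain z where mean_value: "x < z" "z < x + 1" "ln x = Digamma z"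
    using ln_Gamma_real_plus1[OF assms] by auto
  show "Digamma x \<le> ln x" using mean_value assms by (auto intro: Digamma_real_mono)
  have "ln x \<le> Digamma (x + 1)" using mean_value assms by (auto intro: Digamma_real_mono)
  then show "ln x - 1 / x \<le> Digamma x" using Digamma_plus1[of x] assms by simp
qed

lemma ln_Gamma_real_bounds:
  fixes x :: real
  assumes "x \<ge> 1"
  shows "ln_Gamma x \<le> x * ln x - x + 1" and "x * ln x - x + 1 - ln x \<le> ln_Gamma x"
proof -
  have at_1: "ln_Gamma (1::real) = 0" by (simp add: ln_Gamma_real_pos)
  have "ln_Gamma x - (x * ln x - x) \<le> ln_Gamma 1 - (1 * ln 1 - 1)"
  proof (rule DERIV_nonpos_imp_nonincreasing[OF assms, of "\<lambda>x. ln_Gamma x - (x * ln x - x)"])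
    fix s :: real assume "1 \<le> s" "s \<le> x"
    then show "\<exists>y. ((\<lambda>x. ln_Gamma x - (x * ln x - x)) has_real_derivative y) (at s) \<and> y \<le> 0"
      using Digamma_real_bounds[of s]
      by (intro exI[of _ "Digamma s - ln s"] conjI) (auto intro!: derivative_eq_intros)
  qed
  then show "ln_Gamma x \<le> x * ln x - x + 1" by (simp add: at_1)
  have "ln_Gamma 1 - (1 * ln 1 - 1) + ln 1 \<le> ln_Gamma x - (x * ln x - x) + ln x"
  proof (rule DERIV_nonneg_imp_nondecreasing[OF assms, of "\<lambda>x. ln_Gamma x - (x * ln x - x) + ln x"])
    fix s :: real assume "1 \<le> s" "s \<le> x"
    then show "\<exists>y. ((\<lambda>x. ln_Gamma x - (x * ln x - x) + ln x) has_real_derivative y) (at s) \<and> 0 \<le> y"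
      using Digamma_real_bounds[of s]
      by (intro exI[of _ "Digamma s - ln s + 1 / s"] conjI) (auto intro!: derivative_eq_intros)
  qed
  then show "x * ln x - x + 1 - ln x \<le> ln_Gamma x" by (simp add: at_1)
qed

lemma continuous_on_x_ln_x: "continuous_on {0..} (\<lambda>x::real. x * ln x)"
  unfolding continuous_on_def
proof
  fix x :: real assume nonneg: "x \<in> {0..}"
  show "((\<lambda>x. x * ln x) \<longlongrightarrow> x * ln x) (at x within {0..})"
  proof (cases "x = 0")
    case True
    have "((\<lambda>x::real. x * ln x) \<longlongrightarrow> 0) (at_right 0)" by real_asymp
    then show ?thesis using True by (simp add: at_within_Ici_at_right)
  next
    case False
    then show ?thesis using nonneg by (intro tendsto_intros) auto
  qed
qed

lemma ln_real_binom_approx: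
  assumes k_range: "1 \<le> k" "k \<le> n"
  defines "m \<equiv> n - k + 1"
  shows "\<bar>ln (real_binom (n - 1) (k - 1)) / k - (n / k * ln (n / k) - m / k * ln (m / k))\<bar>
    \<le> 3 * (ln n / k)"
proof -
  define L where "L = ln (real_binom (n - 1) (k - 1))"
  define X where "X = n / k * ln (n / k) - m / k * ln (m / k)"
  have m_range: "1 \<le> m" "m \<le> n" using k_range by (auto simp: m_def)
  have "L = ln_Gamma n - ln_Gamma k - ln_Gamma m"
    using k_range by (simp add: L_def real_binom_def Gamma_real_pos_exp m_def ln_div ln_mult)
  moreover have "k * X = n * ln n - k * ln k - m * ln m + ln k"
    using k_range m_range
    by (simp add: X_def ln_div right_diff_distrib) (simp add: m_def algebra_simps)
  moreover have "ln k \<le> ln n" "ln m \<le> ln n" "0 \<le> ln k" "0 \<le> ln m" using k_range m_range by auto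
  ultimately have "\<bar>L - k * X\<bar> \<le> 3 * ln n"
    using ln_Gamma_real_bounds[of n] ln_Gamma_real_bounds[OF k_range(1)]
      ln_Gamma_real_bounds[OF m_range(1)] k_range m_range m_def by linarith
  moreover have "L - k * X = k * (L / k - X)" using k_range by (simp add: right_diff_distrib)
  ultimately have "k * \<bar>L / k - X\<bar> \<le> 3 * ln n" using k_range by (simp add: abs_mult)
  then show ?thesis using k_range by (simp add: L_def X_def le_divide_eq mult.commute)
qed

definition binom_rate :: "real \<Rightarrow> real" where
  "binom_rate a = exp (a * ln a - (a - 1) * ln (a - 1))"

locale convergent_ratio =
  fixes n k :: "'a \<Rightarrow> real" and a :: real and F :: "'a filter"
  assumes bounds: "eventually (\<lambda>i. 1 \<le> k i \<and> k i \<le> n i) F" and k_at_top: "filterlim k at_top F"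
    and ratio: "((\<lambda>i. n i / k i) \<longlongrightarrow> a) F" and nontrivial: "F \<noteq> bot"
begin

lemma limit_ge_1: "a \<ge> 1"
proof (rule tendsto_lowerbound[OF ratio _ nontrivial])
  show "eventually (\<lambda>i. 1 \<le> n i / k i) F" using bounds by eventually_elim simp
qed

lemma inverse_k_tendsto_0: "((\<lambda>i. 1 / k i) \<longlongrightarrow> 0) F"
  using tendsto_inverse_0_at_top[OF k_at_top] by (simp add: divide_inverse)

lemma ln_n_over_k_tendsto_0: "((\<lambda>i. ln (n i) / k i) \<longlongrightarrow> 0) F"
proof (rule Lim_transform_eventually)
  have "((\<lambda>i. ln (k i) / k i) \<longlongrightarrow> 0) F"
    by (rule filterlim_compose[OF _ k_at_top]) real_asymp
  then have "((\<lambda>i. ln (n i / k i) * (1 / k i) + ln (k i) / k i) \<longlongrightarrow> ln a * 0 + 0) F"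
    using limit_ge_1 by (intro tendsto_intros ratio inverse_k_tendsto_0) auto
  then show "((\<lambda>i. ln (n i / k i) * (1 / k i) + ln (k i) / k i) \<longlongrightarrow> 0) F" by simp
  show "eventually (\<lambda>i. ln (n i / k i) * (1 / k i) + ln (k i) / k i = ln (n i) / k i) F"
    using bounds by eventually_elim (simp add: ln_div field_simps)
qed

lemma complementary_ratio: "((\<lambda>i. (n i - k i + 1) / k i) \<longlongrightarrow> a - 1) F"
proof (rule Lim_transform_eventually)
  show "((\<lambda>i. n i / k i - 1 + 1 / k i) \<longlongrightarrow> a - 1) F"
    using tendsto_add[OF tendsto_diff[OF ratio tendsto_const[of 1]] inverse_k_tendsto_0] by simp
  show "eventually (\<lambda>i. n i / k i - 1 + 1 / k i = (n i - k i + 1) / k i) F"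
    using bounds by eventually_elim (simp add: field_simps)
qed

lemma ln_real_binom_over_k_tendsto:
  "((\<lambda>i. ln (real_binom (n i - 1) (k i - 1)) / k i) \<longlongrightarrow> a * ln a - (a - 1) * ln (a - 1)) F"
proof -
  define X where "X i = n i / k i * ln (n i / k i)
    - (n i - k i + 1) / k i * ln ((n i - k i + 1) / k i)" for i
  define L where "L i = ln (real_binom (n i - 1) (k i - 1)) / k i" for i
  have "(X \<longlongrightarrow> a * ln a - (a - 1) * ln (a - 1)) F"
    unfolding X_def using limit_ge_1 bounds
    by (intro tendsto_diff continuous_on_tendsto_compose[OF continuous_on_x_ln_x] ratio
        complementary_ratio) (auto elim!: eventually_mono)
  moreover have "((\<lambda>i. L i - X i) \<longlongrightarrow> 0) F"
  proof (rule Lim_null_comparison)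
    show "eventually (\<lambda>i. norm (L i - X i) \<le> 3 * (ln (n i) / k i)) F"
      using bounds
      by eventually_elim (use ln_real_binom_approx in \<open>simp add: L_def X_def\<close>)
    show "((\<lambda>i. 3 * (ln (n i) / k i)) \<longlongrightarrow> 0) F"
      using tendsto_mult[OF tendsto_const[of 3] ln_n_over_k_tendsto_0] by simp
  qed
  ultimately have "((\<lambda>i. X i + (L i - X i)) \<longlongrightarrow> a * ln a - (a - 1) * ln (a - 1) + 0) F"
    by (rule tendsto_add)
  then show ?thesis by (simp add: L_def)
qed

theorem real_binom_root_tendsto:
  "((\<lambda>i. real_binom (n i - 1) (k i - 1) powr (1 / k i)) \<longlongrightarrow> binom_rate a) F"
proof (rule Lim_transform_eventually)
  show "((\<lambda>i. exp (ln (real_binom (n i - 1) (k i - 1)) / k i)) \<longlongrightarrow> binom_rate a) F"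
    unfolding binom_rate_def by (intro tendsto_exp ln_real_binom_over_k_tendsto)
  show "eventually (\<lambda>i. exp (ln (real_binom (n i - 1) (k i - 1)) / k i) =
      real_binom (n i - 1) (k i - 1) powr (1 / k i)) F"
    using bounds
  proof eventually_elim
    case (elim i)
    then have "real_binom (n i - 1) (k i - 1) > 0" by (simp add: real_binom_pos)
    then show ?case by (simp add: powr_def)
  qed
qed

end

section \<open>The limit of the eigenvalues\<close>

lemma radial_eigenpair_radial_eigenvalue:
  assumes k_range: "1 \<le> k" "k \<le> n"
  obtains u where "radial_eigenpair k n u (radial_eigenvalue k n)"
proof -
  have "\<exists>!l. \<exists>u. radial_eigenpair k n u l"
    using radial_eigenpair_exists[OF k_range] radial_eigenpair_unique[OF _ _ k_range] by blast
  then have "\<exists>u. radial_eigenpair k n u (radial_eigenvalue k n)"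
    unfolding radial_eigenvalue_def by (rule theI')
  then show thesis using that by blast
qed

lemma radial_rate_bounds:
  assumes k_range: "1 \<le> k" "k \<le> n" and "\<eta> > 0"
  defines "M \<equiv> radial_rate k n (radial_eigenvalue k n)"
  shows "critical_rate (n / k - (1 + \<eta>) powr - k) / (1 + \<eta>) \<le> M"
    and "M \<le> (n / k) powr (1 / k) * critical_rate (n / k)"
proof -
  obtain u where eigenpair: "radial_eigenpair k n u (radial_eigenvalue k n)"
    using k_range by (rule radial_eigenpair_radial_eigenvalue)
  show "critical_rate (n / k - (1 + \<eta>) powr - k) / (1 + \<eta>) \<le> M"
    using critical_rate_le_radial_rate[OF eigenpair k_range \<open>\<eta> > 0\<close>] \<open>\<eta> > 0\<close>
    by (simp add: M_def divide_le_eq mult.commute)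
  show "M \<le> (n / k) powr (1 / k) * critical_rate (n / k)"
    unfolding M_def
    by (rule radial_solution.radial_rate_le[OF
          radial_eigenpair_imp_radial_solution[OF eigenpair k_range]])
qed

context convergent_ratio
begin

lemma radial_rate_tendsto:
  "((\<lambda>i. radial_rate (k i) (n i) (radial_eigenvalue (k i) (n i))) \<longlongrightarrow> critical_rate a) F"
proof -
  define \<eta> where "\<eta> i = 1 / sqrt (k i)" for i
  have \<eta>_tendsto_0: "(\<eta> \<longlongrightarrow> 0) F"
    unfolding \<eta>_def by (rule filterlim_compose[OF _ k_at_top]) real_asymp
  have forcing: "((\<lambda>i. (1 + \<eta> i) powr - k i) \<longlongrightarrow> 0) F"
    unfolding \<eta>_def by (rule filterlim_compose[OF _ k_at_top]) real_asymp
  have critical: "isCont critical_rate a"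
    using limit_ge_1 by (intro isCont_critical_rate) simp
  have "((\<lambda>i. n i / k i - (1 + \<eta> i) powr - k i) \<longlongrightarrow> a) F"
    using tendsto_diff[OF ratio forcing] by simp
  then have "((\<lambda>i. critical_rate (n i / k i - (1 + \<eta> i) powr - k i) / (1 + \<eta> i))
      \<longlongrightarrow> critical_rate a / (1 + 0)) F"
    by (intro tendsto_divide isCont_tendsto_compose[OF critical] tendsto_add tendsto_const \<eta>_tendsto_0)
      auto
  then have lower: "((\<lambda>i. critical_rate (n i / k i - (1 + \<eta> i) powr - k i) / (1 + \<eta> i))
      \<longlongrightarrow> critical_rate a) F" by simp
  have "((\<lambda>i. (n i / k i) powr (1 / k i) * critical_rate (n i / k i))
      \<longlongrightarrow> a powr 0 * critical_rate a) F"
    using limit_ge_1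
    by (intro tendsto_mult tendsto_powr isCont_tendsto_compose[OF critical] ratio
        inverse_k_tendsto_0) auto
  then have upper: "((\<lambda>i. (n i / k i) powr (1 / k i) * critical_rate (n i / k i))
      \<longlongrightarrow> critical_rate a) F"
    using limit_ge_1 by simp
  have "eventually (\<lambda>i. 0 < \<eta> i) F"
    using bounds by eventually_elim (simp add: \<eta>_def)
  with bounds have valid: "eventually (\<lambda>i. 1 \<le> k i \<and> k i \<le> n i \<and> 0 < \<eta> i) F"
    by eventually_elim simp
  show ?thesis
    by (rule tendsto_sandwich[OF _ _ lower upper])
      (use valid in \<open>auto elim!: eventually_mono intro: radial_rate_bounds\<close>)
qed

theorem radial_eigenvalue_tendsto:
  "((\<lambda>i. radial_eigenvalue (k i) (n i)) \<longlongrightarrow> binom_rate a * critical_rate a) F"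
proof (rule Lim_transform_eventually)
  show "((\<lambda>i. real_binom (n i - 1) (k i - 1) powr (1 / k i) *
      radial_rate (k i) (n i) (radial_eigenvalue (k i) (n i))) \<longlongrightarrow> binom_rate a * critical_rate a) F"
    by (intro tendsto_mult real_binom_root_tendsto radial_rate_tendsto)
  show "eventually (\<lambda>i. real_binom (n i - 1) (k i - 1) powr (1 / k i) *
      radial_rate (k i) (n i) (radial_eigenvalue (k i) (n i)) = radial_eigenvalue (k i) (n i)) F"
    using bounds
  proof eventually_elim
    case (elim i)
    then have "real_binom (n i - 1) (k i - 1) > 0" by (simp add: real_binom_pos)
    then show ?case by (simp add: radial_rate_def)
  qed
qed

end

lemma filterlim_denominator_at_top:
  fixes n k :: "'a \<Rightarrow> real"
  assumes pos: "eventually (\<lambda>i. k i > 0) F" and n_at_top: "filterlim n at_top F"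
    and ratio: "((\<lambda>i. n i / k i) \<longlongrightarrow> a) F"
  shows "filterlim k at_top F"
proof (rule filterlim_at_top_mono)
  show "filterlim (\<lambda>i. n i * (1 / (\<bar>a\<bar> + 1))) at_top F"
    by (rule filterlim_at_top_mult_tendsto_pos[OF tendsto_const _ n_at_top])
      (simp add: add_nonneg_pos)
  have "eventually (\<lambda>i. n i / k i < \<bar>a\<bar> + 1) F"
    by (rule order_tendstoD[OF ratio]) linarith
  with pos show "eventually (\<lambda>i. n i * (1 / (\<bar>a\<bar> + 1)) \<le> k i) F"
    by eventually_elim (simp add: divide_less_eq divide_le_eq add_nonneg_pos mult.commute)
qed

lemma binom_rate_mult_critical_rate:
  assumes "a \<ge> 1"
  shows "binom_rate a * critical_rate a = limit_value a"
proof -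
  have exp_2_ln_2: "exp (2 * ln 2) = (4::real)"
    by (simp add: exp_double)
  consider (one) "a = 1" | (two) "a = 2" | (generic) "a \<noteq> 1" "a \<noteq> 2" by blast
  then show ?thesis
  proof cases
    case one
    then show ?thesis
      using exp_2_ln_2
      by (simp add: critical_rate_eq_exp binom_rate_def critical_exponent_def limit_value_def)
  next
    case two
    then show ?thesis
      using exp_2_ln_2
      by (simp add: critical_rate_eq_exp binom_rate_def critical_exponent_def limit_value_def
          mult.commute)
  next
    case generic
    have "binom_rate a = a powr a / (a - 1) powr (a - 1)"
      using assms generic by (simp add: binom_rate_def powr_def exp_diff)
    moreover have "a powr (a + 1) = a powr a * a" using assms by (simp add: powr_add)
    moreover have "(2 / a) powr (2 / (2 - a)) = exp (2 * critical_exponent a)"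
      using assms generic by (simp add: powr_def critical_exponent_def)
    ultimately show ?thesis
      using generic by (simp add: critical_rate_eq_exp limit_value_def limit_expr_def)
  qed
qed

theorem theorem1p1:
  fixes n k :: "nat \<Rightarrow> real" and \<alpha> :: real
  assumes "\<And>i. i \<ge> 1 \<Longrightarrow> 1 \<le> k i \<and> k i \<le> n i"
    and "filterlim n at_top sequentially"
    and "(\<lambda>i. n i / k i) \<longlonglongrightarrow> \<alpha>"
  shows "(\<lambda>i. radial_eigenvalue (k i) (n i)) \<longlonglongrightarrow> limit_value \<alpha>"
proof -
  have bounds: "eventually (\<lambda>i. 1 \<le> k i \<and> k i \<le> n i) sequentially"
    using assms(1) by (auto simp: eventually_sequentially)
  then have "eventually (\<lambda>i. k i > 0) sequentially" by eventually_elim simp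
  then have "filterlim k at_top sequentially"
    using assms(2,3) by (rule filterlim_denominator_at_top)
  then interpret convergent_ratio n k \<alpha> sequentially
    using bounds assms(3) by unfold_locales auto
  show ?thesis
    using radial_eigenvalue_tendsto binom_rate_mult_critical_rate[OF limit_ge_1] by simp
qed

end
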